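(* Let $P\subset\mathbb{R}^2$ be a rational polygon (all vertices have rational coordinates) with $k$ vertices and no two parallel edges. Then there exists an odd cover $\mathcal{F}=\{P+z\}_{z\in Z}$ of $\mathbb{R}^2$ by translates of $P$, of uniformly bounded degree, with density $\rho(\mathcal{F})\le A_{\rm INT}(P)\cdot 2^{k-1}$. Consequently, $\alpha^\circ(P)\ge A_{\rm INT}(P)^{-1}\cdot 2^{-(k-1)}$.
   Context: All covering statements are up to sets of Lebesgue measure $0$. $A(X)$ denotes the area of $X$. For a rational polygon $P$, $P_{\rm INT}$ is an integer polygon (all vertices in $\mathbb{Z}^2$) of minimal area among integer polygons affinely equivalent to $P$ (images of $P$ under non-singular affine maps), and $A_{\rm INT}(P)=A(P_{\rm INT})$. For a compact set $X$ and a discrete set $Z\subseteq\mathbb{R}^2$ (translates with multiplicity allowed), the family $\mathcal{F}=\{X+z\}_{z\in Z}$ has uniformly bounded degree if there is a constant $d$ such that every point of $\mathbb{R}^2$ lies in at most $d$ members of $\mathcal{F}$. Such an $\mathcal{F}$ is an odd cover of $\mathbb{R}^2$ if almost every point of $\mathbb{R}^2$ lies in an odd number of members of $\mathcal{F}$. Its density is $\rho(\mathcal{F})=\liminf_{n\to\infty} n^{-2}\sum_{z\in Z}A(Q_n\cap(X+z))$, where $Q_n$ is the $n\times n$ axis-parallel square centered at the origin. For a compact $X$ with $0<A(X)<\infty$, the odd area $A_{odd}(X)$ is the infimum, over all finite sets $K\subset\mathbb{R}^2$ of odd cardinality, of the area of the set of points lying in an odd number of the translates $X+k$, $k\in K$;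 the odd compression ratio is $\alpha^\circ(X)=A_{odd}(X)/A(X)$. *)

theory Defs
  imports "HOL-Analysis.Analysis"
begin

fun polygonal_path :: "(real^2) list \<Rightarrow> real \<Rightarrow> real^2" where
  "polygonal_path [] = linepath 0 0"
| "polygonal_path [a] = linepath a a"
| "polygonal_path [a, b] = linepath a b"
| "polygonal_path (a # b # c # xs) = linepath a b +++ polygonal_path (b # c # xs)"

definition boundary_path :: "(real^2) list \<Rightarrow> real \<Rightarrow> real^2" where
  "boundary_path vs = polygonal_path (vs @ [hd vs])"

abbreviation next_vertex :: "(real^2) list \<Rightarrow> nat \<Rightarrow> real^2" where
  "next_vertex vs i \<equiv> vs ! (Suc i mod length vs)"

text \<open>Polygons are simple closed polygons together with their interior. The last condition, that
  no three consecutive vertices are collinear, makes the listed points exactly the vertices.\<close>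

definition polygon_with_vertices :: "(real^2) set \<Rightarrow> (real^2) list \<Rightarrow> bool" where
  "polygon_with_vertices P vs \<longleftrightarrow>
     3 \<le> length vs \<and>
     simple_path (boundary_path vs) \<and>
     P = path_image (boundary_path vs) \<union> inside (path_image (boundary_path vs)) \<and>
     (\<forall>i<length vs.
        \<not> collinear {vs ! i, vs ! (Suc i mod length vs), vs ! (Suc (Suc i) mod length vs)})"

definition rational_point :: "real^2 \<Rightarrow> bool" where
  "rational_point v \<longleftrightarrow> (\<forall>j. v $ j \<in> \<rat>)"

definition integer_point :: "real^2 \<Rightarrow> bool" where
  "integer_point v \<longleftrightarrow> (\<forall>j. v $ j \<in> \<int>)"

definition integer_polygon :: "(real^2) set \<Rightarrow> bool" where
  "integer_polygon Q \<longleftrightarrow> (\<exists>vs. polygon_with_vertices Q vs \<and> (\<forall>v\<in>set vs. integer_point v))"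

definition parallel :: "real^2 \<Rightarrow> real^2 \<Rightarrow> bool" where
  "parallel u v \<longleftrightarrow> collinear {0, u, v}"

definition no_parallel_edges :: "(real^2) list \<Rightarrow> bool" where
  "no_parallel_edges vs \<longleftrightarrow>
     (\<forall>i<length vs. \<forall>j<length vs. i \<noteq> j \<longrightarrow>
        \<not> parallel (next_vertex vs i - vs ! i) (next_vertex vs j - vs ! j))"

definition affinely_equivalent :: "(real^2) set \<Rightarrow> (real^2) set \<Rightarrow> bool" where
  "affinely_equivalent P Q \<longleftrightarrow>
     (\<exists>(A::real^2^2) b. invertible A \<and> Q = (\<lambda>x. A *v x + b) ` P)"

abbreviation area :: "(real^2) set \<Rightarrow> real" where
  "area X \<equiv> measure lebesgue X"

text \<open>For a rational polygon some integer polygon is affinely equivalent to it, and the areas of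
  such integer polygons are positive half-integers, so the minimum below is attained.\<close>

definition P_INT :: "(real^2) set \<Rightarrow> (real^2) set" where
  "P_INT P = (ARG_MIN area Q. integer_polygon Q \<and> affinely_equivalent P Q)"

definition A_INT :: "(real^2) set \<Rightarrow> real" where
  "A_INT P = area (P_INT P)"

text \<open>A family of translates of \<open>X\<close>, with multiplicity, is given by a function \<open>m\<close>: the translate
  \<open>X + z\<close> occurs \<open>m z\<close> times. Its members are thus indexed by the pairs \<open>(z, i)\<close> with \<open>i < m z\<close>.\<close>

definition discrete_translations :: "(real^2 \<Rightarrow> nat) \<Rightarrow> bool" where
  "discrete_translations m \<longleftrightarrow> discrete {z. 0 < m z}"

definition members_at :: "(real^2) set \<Rightarrow> (real^2 \<Rightarrow> nat) \<Rightarrow> real^2 \<Rightarrow> ((real^2) \<times> nat) set" where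
  "members_at X m x = {(z, i). i < m z \<and> x \<in> (+) z ` X}"

definition uniformly_bounded_degree :: "(real^2) set \<Rightarrow> (real^2 \<Rightarrow> nat) \<Rightarrow> bool" where
  "uniformly_bounded_degree X m \<longleftrightarrow>
     (\<exists>d. \<forall>x. finite (members_at X m x) \<and> card (members_at X m x) \<le> d)"

text \<open>The cardinality of an infinite set is \<open>0\<close>, so \<open>odd\<close> below includes finiteness.\<close>

definition odd_cover :: "(real^2) set \<Rightarrow> (real^2 \<Rightarrow> nat) \<Rightarrow> bool" where
  "odd_cover X m \<longleftrightarrow> (AE x in lebesgue. odd (card (members_at X m x)))"

definition centered_square :: "nat \<Rightarrow> (real^2) set" where
  "centered_square n = cbox (\<chi> j. - (real n / 2)) (\<chi> j. real n / 2)"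

definition cover_density :: "(real^2) set \<Rightarrow> (real^2 \<Rightarrow> nat) \<Rightarrow> ennreal" where
  "cover_density X m =
     liminf (\<lambda>n. (\<Sum>\<^sub>\<infinity>z\<in>{z. 0 < m z}.
                    of_nat (m z) * emeasure lebesgue (centered_square n \<inter> (+) z ` X))
                  / ennreal ((real n)\<^sup>2))"

definition odd_area :: "(real^2) set \<Rightarrow> real" where
  "odd_area X =
     (INF K\<in>{K. finite K \<and> odd (card K)}. area {x. odd (card {k\<in>K. x \<in> (+) k ` X})})"

definition odd_compression_ratio :: "(real^2) set \<Rightarrow> real" where
  "odd_compression_ratio X = odd_area X / area X"

end

theory Submission
  imports Defs
begin

text \<open>Pass to \<open>Q = P_INT P\<close>, the image of \<open>P\<close> under \<open>x \<mapsto> A x + b\<close>, and let \<open>F x\<close> be the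
  parity of the number of translates of \<open>Q\<close> by \<open>\<int>\<^sup>2\<close> that contain \<open>x\<close>. By the Jordan curve theorem \<open>F\<close>
  flips whenever an edge is crossed. Write the edges as \<open>d\<^sub>i p\<^sub>i\<close> with \<open>p\<^sub>i\<close> primitive; then the translates of
  the \<open>i\<close>-th edge cover each line \<open>det (p\<^sub>i, x) \<in> \<int>\<close> exactly \<open>d\<^sub>i\<close> times, and hence
  \<open>F x = c + (\<Sum>i. d\<^sub>i \<lfloor>det (p\<^sub>i, x)\<rfloor>)\<close> modulo 2.

  Let \<open>T\<^sub>h\<close> be the translation by \<open>h\<close>. The operator \<open>1 + T\<^sub>h\<close> with \<open>h\<close> parallel to \<open>p\<^sub>i\<close> kills the \<open>i\<close>-th
  summand. By minimality of the area some \<open>d\<^sub>l\<close> is odd. Use one such operator for every \<open>i \<noteq> l\<close>, with lengths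
  chosen so that the shifts act on \<open>det (p\<^sub>l, x)\<close> as \<open>c, c, 2 c, 4 c, \<dots>\<close> with sum 1: the product acts on the
  \<open>l\<close>-th summand as \<open>1 + T\<close> with \<open>T\<close> a unit shift and turns \<open>F\<close> into the constant 1. This
  gives an odd cover of the plane by \<open>2\<^bsup>k - 1\<^esup>\<close> lattice families of translates, and pulling it back by
  \<open>A\<close> gives one for \<open>P\<close> whose lattice has covolume \<open>1 / \<bar>det A\<bar> = area P / A_INT P\<close>.

  For \<open>K\<close> of odd cardinality, adding the \<open>K\<close>-translates of this cover shows that the translates of the odd
  set of \<open>P + K\<close> by the same \<open>2\<^bsup>k - 1\<^esup>\<close> lattice cosets cover the plane, which bounds its area from below.\<close>

section \<open>Polygonal paths and their edges\<close>

definition edge :: "(real^2) list \<Rightarrow> nat \<Rightarrow> (real^2) set" where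
  "edge vs i = closed_segment (vs ! i) (next_vertex vs i)"

lemma polygonal_path_ends:
  "xs \<noteq> [] \<Longrightarrow> pathstart (polygonal_path xs) = hd xs \<and> pathfinish (polygonal_path xs) = last xs"
  by (induction xs rule: polygonal_path.induct) auto

lemma path_image_polygonal_path:
  "2 \<le> length xs \<Longrightarrow>
    path_image (polygonal_path xs) = (\<Union>i<length xs - 1. closed_segment (xs ! i) (xs ! Suc i))"
proof (induction xs rule: polygonal_path.induct)
  case (4 a b c xs)
  have "{..<length (a # b # c # xs) - 1} = insert 0 (Suc ` {..<length (b # c # xs) - 1})"
    by (simp add: lessThan_Suc_eq_insert_0)
  then show ?case
    using 4 by (simp add: path_image_join polygonal_path_ends)
qed auto

text \<open>By induction: \<open>arc_join_eq\<close> confines the intersection of the first segment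
  with the rest of the path to their joint, and the rest is an arc again.\<close>

lemma arc_polygonal_path_edges:
  assumes "arc (polygonal_path xs)" "2 \<le> length xs"
  shows "(\<forall>i<length xs - 1. xs ! i \<noteq> xs ! Suc i) \<and>
    (\<forall>i j. i < j \<longrightarrow> j < length xs - 1 \<longrightarrow>
      closed_segment (xs ! i) (xs ! Suc i) \<inter> closed_segment (xs ! j) (xs ! Suc j) \<subseteq> {xs ! Suc i})"
  using assms
proof (induction xs rule: polygonal_path.induct)
  case (3 a b)
  then show ?case
    using arc_distinct_ends[of "linepath a b"] by auto
next
  case (4 a b c xs)
  define ys where "ys = b # c # xs"
  have eq: "polygonal_path (a # ys) = linepath a b +++ polygonal_path ys"
    by (simp add: ys_def)
  have arcs: "arc (linepath a b)" "arc (polygonal_path ys)"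
    and meet: "closed_segment a b \<inter> path_image (polygonal_path ys) \<subseteq> {b}"
    using 4(2) eq arc_join_eq[of "linepath a b" "polygonal_path ys"] polygonal_path_ends[of ys]
    by (auto simp: ys_def)
  have ab: "a \<noteq> b"
    using arcs(1) arc_distinct_ends by fastforce
  have IH: "(\<forall>i<length ys - 1. ys ! i \<noteq> ys ! Suc i) \<and>
    (\<forall>i j. i < j \<longrightarrow> j < length ys - 1 \<longrightarrow>
      closed_segment (ys ! i) (ys ! Suc i) \<inter> closed_segment (ys ! j) (ys ! Suc j) \<subseteq> {ys ! Suc i})"
    using 4(1) arcs(2) by (simp add: ys_def)
  have img: "path_image (polygonal_path ys) =
      (\<Union>i<length ys - 1. closed_segment (ys ! i) (ys ! Suc i))"
    by (rule path_image_polygonal_path) (simp add: ys_def)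
  have "(a # ys) ! i \<noteq> (a # ys) ! Suc i" if "i < length (a # ys) - 1" for i
    using that IH ab by (cases i) (auto simp: ys_def)
  moreover have "closed_segment ((a # ys) ! i) ((a # ys) ! Suc i) \<inter>
      closed_segment ((a # ys) ! j) ((a # ys) ! Suc j) \<subseteq> {(a # ys) ! Suc i}"
    if ij: "i < j" "j < length (a # ys) - 1" for i j
  proof -
    obtain j' where j': "j = Suc j'" "j' < length ys - 1"
      using ij by (cases j) (auto simp: ys_def)
    show ?thesis
    proof (cases i)
      case 0
      have "closed_segment (ys ! j') (ys ! Suc j') \<subseteq> path_image (polygonal_path ys)"
        using j' by (auto simp: img)
      then show ?thesis
        using meet 0 j' by (auto simp: ys_def)
    next
      case (Suc i')
      then show ?thesis using IH ij j' by auto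
    qed
  qed
  ultimately show ?case by (simp only: ys_def) blast
qed auto

lemma boundary_path_nth:
  assumes "i < length vs"
  shows "(vs @ [hd vs]) ! i = vs ! i" "(vs @ [hd vs]) ! Suc i = next_vertex vs i"
proof -
  show "(vs @ [hd vs]) ! i = vs ! i" using assms by (simp add: nth_append)
  show "(vs @ [hd vs]) ! Suc i = next_vertex vs i"
  proof (cases "Suc i = length vs")
    case True
    then have "vs \<noteq> []" by auto
    then show ?thesis using True by (simp add: nth_append hd_conv_nth)
  qed (use assms in \<open>simp add: nth_append\<close>)
qed

lemma path_image_boundary_path:
  assumes "vs \<noteq> []"
  shows "path_image (boundary_path vs) = (\<Union>i<length vs. edge vs i)"
proof -
  have "path_image (boundary_path vs) =
      (\<Union>i<length vs. closed_segment ((vs @ [hd vs]) ! i) ((vs @ [hd vs]) ! Suc i))"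
    unfolding boundary_path_def using assms
    by (subst path_image_polygonal_path) (auto simp: Suc_le_eq)
  then show ?thesis
    by (simp add: edge_def boundary_path_nth)
qed

lemma boundary_path_ends:
  assumes "vs \<noteq> []"
  shows "pathstart (boundary_path vs) = hd vs" "pathfinish (boundary_path vs) = hd vs"
  using assms polygonal_path_ends[of "vs @ [hd vs]"] by (auto simp: boundary_path_def)

text \<open>The loop is the first edge joined to an arc that leads back to its start. These two
  pieces may meet at both ends of the first edge, hence the extra point \<open>vs ! 0\<close> for
  \<open>i = 0\<close>; within the arc \<open>arc_polygonal_path_edges\<close> applies.\<close>

lemma simple_boundary_edges:
  assumes "3 \<le> length vs" "simple_path (boundary_path vs)"
  shows "\<And>i. i < length vs \<Longrightarrow> vs ! i \<noteq> next_vertex vs i"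
    and "\<And>i j. i < j \<Longrightarrow> j < length vs \<Longrightarrow>
      edge vs i \<inter> edge vs j \<subseteq> {next_vertex vs i} \<union> (if i = 0 then {vs ! 0} else {})"
proof -
  obtain a b c xs where vs: "vs = a # b # c # xs"
    using assms(1) by (cases vs rule: polygonal_path.cases) auto
  define ys where "ys = b # c # xs @ [a]"
  have ys: "vs @ [hd vs] = a # ys" by (simp add: vs ys_def)
  have eq: "boundary_path vs = linepath a b +++ polygonal_path ys"
    by (simp add: boundary_path_def vs ys_def)
  have ends: "pathstart (polygonal_path ys) = b" "pathfinish (polygonal_path ys) = a"
    using polygonal_path_ends[of ys] by (auto simp: ys_def)
  have arcs: "arc (linepath a b)" "arc (polygonal_path ys)"
    and meet: "closed_segment a b \<inter> path_image (polygonal_path ys) \<subseteq> {a, b}"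
    using assms(2) simple_path_join_loop_eq[of "polygonal_path ys" "linepath a b"]
    by (auto simp: eq ends)
  have ab: "a \<noteq> b"
    using arcs(1) arc_distinct_ends by fastforce
  have rest: "(\<forall>i<length ys - 1. ys ! i \<noteq> ys ! Suc i) \<and>
    (\<forall>i j. i < j \<longrightarrow> j < length ys - 1 \<longrightarrow>
      closed_segment (ys ! i) (ys ! Suc i) \<inter> closed_segment (ys ! j) (ys ! Suc j) \<subseteq> {ys ! Suc i})"
    by (rule arc_polygonal_path_edges[OF arcs(2)]) (simp add: ys_def)
  have img: "path_image (polygonal_path ys) =
      (\<Union>i<length ys - 1. closed_segment (ys ! i) (ys ! Suc i))"
    by (rule path_image_polygonal_path) (simp add: ys_def)
  have len: "length vs = length ys" by (simp add: vs ys_def)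
  have nth: "vs ! i = (a # ys) ! i" "next_vertex vs i = (a # ys) ! Suc i"
    if "i < length ys" for i
    using boundary_path_nth[of i vs] that unfolding ys len by auto
  show "vs ! i \<noteq> next_vertex vs i" if "i < length vs" for i
  proof (cases i)
    case 0
    then show ?thesis using ab by (simp add: vs)
  next
    case (Suc i')
    then have "vs ! i = ys ! i'" "next_vertex vs i = ys ! Suc i'"
      using nth[of i] that len by auto
    then show ?thesis using rest that Suc len by auto
  qed
  show "edge vs i \<inter> edge vs j \<subseteq> {next_vertex vs i} \<union> (if i = 0 then {vs ! 0} else {})"
    if ij: "i < j" "j < length vs" for i j
  proof -
    obtain j' where j': "j = Suc j'" "j' < length ys - 1"
      using ij len by (cases j) auto
    have ej: "edge vs j = closed_segment (ys ! j') (ys ! Suc j')"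
      using nth[of j] j' ij len by (simp add: edge_def)
    show ?thesis
    proof (cases i)
      case 0
      have "edge vs j \<subseteq> path_image (polygonal_path ys)"
        unfolding img ej using j'(2) by auto
      then show ?thesis
        using meet 0 by (auto simp: edge_def vs)
    next
      case (Suc i')
      have "edge vs i = closed_segment (ys ! i') (ys ! Suc i')"
        using nth[of i] ij Suc len by (simp add: edge_def)
      moreover have "next_vertex vs i = ys ! Suc i'"
        using nth[of i] ij Suc len by simp
      ultimately show ?thesis using rest ij Suc j' ej by auto
    qed
  qed
qed

lemma polygon_edges:
  assumes "polygon_with_vertices P vs"
  shows "3 \<le> length vs" "vs \<noteq> []"
    and "\<And>i. i < length vs \<Longrightarrow> vs ! i \<noteq> next_vertex vs i"
    and "\<And>i j. i < j \<Longrightarrow> j < length vs \<Longrightarrow>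
      edge vs i \<inter> edge vs j \<subseteq> {next_vertex vs i} \<union> (if i = 0 then {vs ! 0} else {})"
  using assms simple_boundary_edges[of vs] by (auto simp: polygon_with_vertices_def)

lemma next_vertex_last: "vs \<noteq> [] \<Longrightarrow> next_vertex vs (length vs - 1) = vs ! 0"
  by (metis Suc_diff_1 length_greater_0_conv mod_self)

text \<open>A repeated vertex would be a common point of the two edges that start there, and the
  bounds in \<open>polygon_edges\<close> leave only \<open>vs ! 0\<close> for such a point.\<close>

lemma polygon_vertices_distinct:
  assumes "polygon_with_vertices P vs"
  shows "distinct vs"
proof -
  note facts = polygon_edges[OF assms]
  define n where "n = length vs"
  have n: "3 \<le> n" using facts(1) by (simp add: n_def)
  have False if "a < b" "b < n" "vs ! a = vs ! b" for a b
  proof -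
    have start: "vs ! i \<in> edge vs i" for i by (simp add: edge_def)
    have "vs ! a \<in> edge vs a \<inter> edge vs b"
      using start[of a] start[of b] that by simp
    then have a: "a = 0"
      using facts(3)[of a] facts(4)[of a b] that by (auto simp: n_def split: if_splits)
    have last: "next_vertex vs (n - 1) = vs ! 0"
      using next_vertex_last[OF facts(2)] by (simp add: n_def)
    show False
    \<comment> \<open>The last edge also ends at \<open>vs ! 0\<close>: either it would be
      degenerate, or it would meet edge \<open>b\<close> at the start of edge
      \<open>b\<close>.\<close>
    proof (cases "b = n - 1")
      case True
      have "b < length vs" using that by (simp add: n_def)
      then show False using facts(3)[of b] last a that True by metis
    next
      case False
      have "vs ! 0 \<in> edge vs (n - 1)"
        using last by (simp add: edge_def n_def)
      then have "vs ! b \<in> edge vs b \<inter> edge vs (n - 1)"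
        using start[of b] that a by simp
      moreover have "b < n - 1" using False that by linarith
      ultimately show False
        using facts(2) facts(3)[of b] facts(4)[of b "n - 1"] that False a
        by (auto simp: n_def split: if_splits)
    qed
  qed
  then show ?thesis
    unfolding distinct_conv_nth n_def[symmetric] by (metis nat_neq_iff)
qed

lemma vertex_in_edge:
  assumes "polygon_with_vertices P vs" "i < length vs" "j < length vs" "vs ! i \<in> edge vs j"
  shows "j = i \<or> Suc j mod length vs = i"
proof (rule ccontr)
  assume neg: "\<not> ?thesis"
  note facts = polygon_edges[OF assms(1)]
  define n where "n = length vs"
  have n: "3 \<le> n" using facts(1) by (simp add: n_def)
  have dist: "vs ! a = vs ! b \<longleftrightarrow> a = b" if "a < n" "b < n" for a b
    using polygon_vertices_distinct[OF assms(1)] that by (simp add: n_def nth_eq_iff_index_eq)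
  have i: "vs ! i \<in> edge vs i" by (simp add: edge_def)
  have lt: "i < n" "j < n" using assms by (auto simp: n_def)
  have modlt: "Suc j mod n < n" using n by simp
  consider "i < j" | "j < i" using neg by linarith
  then show False
  proof cases
    case 1
    \<comment> \<open>Only vertex 0 can be the exceptional common point. It is also the end of the
      last edge, and comparing edge \<open>j\<close> with the last edge makes it the end of edge
      \<open>j\<close>.\<close>
    then have i0: "i = 0"
      using i facts(3)[of i] facts(4)[of i j] assms by (auto split: if_splits)
    have jn: "j < n - 1"
      using neg i0 lt by (cases "j = n - 1") (auto simp: n_def)
    have last: "vs ! 0 \<in> edge vs (n - 1)"
      using next_vertex_last[OF facts(2)] by (simp add: n_def edge_def)
    have "vs ! 0 = next_vertex vs j \<or> j = 0"
      using facts(4)[of j "n - 1"] jn last assms(4) i0 facts(2)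
      by (auto simp: n_def split: if_splits)
    then show False
      using dist[of 0 "Suc j mod n"] 1 neg i0 n modlt facts(2) by (auto simp: n_def)
  next
    case 2
    have "vs ! i = next_vertex vs j \<or> (j = 0 \<and> vs ! i = vs ! 0)"
      using facts(4)[OF 2] i assms by (auto split: if_splits)
    then show False
      using dist[of i "Suc j mod n"] dist[of i 0] lt modlt n neg by (auto simp: n_def)
  qed
qed

lemma edges_meet_at_vertex:
  assumes "polygon_with_vertices P vs" "i < length vs" "j < length vs" "i \<noteq> j"
    "x \<in> edge vs i" "x \<in> edge vs j"
  shows "x \<in> set vs"
proof -
  note facts = polygon_edges[OF assms(1)]
  have "x \<in> set vs" if "a < b" "b < length vs" "x \<in> edge vs a" "x \<in> edge vs b" for a b
  proof -
    have "next_vertex vs a \<in> set vs"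
      by (rule nth_mem, rule mod_less_divisor) (use facts(2) in simp)
    moreover have "vs ! 0 \<in> set vs"
      by (rule nth_mem) (use facts(2) in simp)
    moreover have "x = next_vertex vs a \<or> x = vs ! 0"
      using facts(4)[OF that(1,2)] that(3,4) by (auto split: if_splits)
    ultimately show ?thesis by metis
  qed
  then show ?thesis using assms by (metis nat_neq_iff)
qed

text \<open>Among the points \<open>y m\<close>, which tend to \<open>x\<close>, infinitely many lie
  in one edge by the pigeonhole principle; that edge is closed and so contains the limit
  \<open>x\<close> as well.\<close>

lemma ray_in_edge:
  fixes x w :: "real^2"
  assumes "\<And>t. 0 \<le> t \<Longrightarrow> t \<le> 1 \<Longrightarrow> x + t *\<^sub>R w \<in> (\<Union>i<n. edge vs i)"
  shows "\<exists>j<n. \<exists>t>0. x \<in> edge vs j \<and> x + t *\<^sub>R w \<in> edge vs j"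
proof -
  define y where "y m = x + (1 / real (Suc m)) *\<^sub>R w" for m
  have "\<forall>m\<in>UNIV. \<exists>j\<in>{..<n}. y m \<in> edge vs j"
    using assms by (auto simp: y_def)
  from pigeonhole_infinite_rel[OF infinite_UNIV_nat _ this]
  obtain j where j: "j < n" "infinite {m. y m \<in> edge vs j}" by auto
  have "y \<longlonglongrightarrow> x + 0 *\<^sub>R w"
    unfolding y_def by (intro tendsto_intros LIMSEQ_Suc lim_1_over_n)
  then have lim: "y \<longlonglongrightarrow> x" by simp
  have "x \<in> edge vs j"
  proof (rule ccontr)
    assume "x \<notin> edge vs j"
    then have "open (- edge vs j)" "x \<in> - edge vs j"
      by (auto simp: edge_def)
    then have "\<forall>\<^sub>F m in sequentially. y m \<in> - edge vs j"
      using lim topological_tendstoD by blast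
    then have "finite {m. y m \<in> edge vs j}"
      unfolding cofinite_eq_sequentially[symmetric] eventually_cofinite by simp
    then show False using j by blast
  qed
  moreover obtain m where "y m \<in> edge vs j"
    using j by (metis (mono_tags, lifting) finite.emptyI empty_Collect_eq)
  ultimately show ?thesis
    using j(1) by (intro exI[of _ j] conjI exI[of _ "1 / real (Suc m)"]) (auto simp: y_def)
qed

text \<open>The vertices are exactly the boundary points that are not midpoints of a boundary segment;
  hence they are determined by the polygon as a point set.\<close>

lemma vertex_not_inner:
  assumes "polygon_with_vertices P vs" "i < length vs" "u \<noteq> 0"
  shows "\<not> closed_segment (vs ! i - u) (vs ! i + u) \<subseteq> (\<Union>i<length vs. edge vs i)"
proof
  assume sub: "closed_segment (vs ! i - u) (vs ! i + u) \<subseteq> (\<Union>i<length vs. edge vs i)"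
  define n where "n = length vs"
  define x where "x = vs ! i"
  have n: "3 \<le> n" using polygon_edges(1)[OF assms(1)] by (simp add: n_def)
  have seg: "x + t *\<^sub>R u \<in> (\<Union>i<n. edge vs i)" if "-1 \<le> t" "t \<le> 1" for t
  proof -
    have "x + t *\<^sub>R u = (1 - (t + 1) / 2) *\<^sub>R (x - u) + ((t + 1) / 2) *\<^sub>R (x + u)"
      by (simp add: vec_eq_iff field_simps)
    moreover have "0 \<le> (t + 1) / 2" "(t + 1) / 2 \<le> 1" using that by auto
    ultimately have "x + t *\<^sub>R u \<in> closed_segment (x - u) (x + u)"
      unfolding closed_segment_def by blast
    then show ?thesis using sub by (auto simp: x_def n_def)
  qed
  have "x + t *\<^sub>R (- u) \<in> (\<Union>i<n. edge vs i)" if "0 \<le> t" "t \<le> 1" for t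
    using seg[of "- t"] that by simp
  \<comment> \<open>The segment leaves the vertex in the directions \<open>- u\<close> and
    \<open>u\<close>; each direction is followed by some edge through the vertex.\<close>
  then obtain j s where j: "j < n" "s > 0" "x \<in> edge vs j" "x + s *\<^sub>R (- u) \<in> edge vs j"
    using ray_in_edge[where x=x and w="-u" and n=n and vs=vs] by blast
  obtain k t where k: "k < n" "t > 0" "x \<in> edge vs k" "x + t *\<^sub>R u \<in> edge vs k"
    using ray_in_edge[where x=x and w=u and n=n and vs=vs] seg by force
  have jk: "j = i \<or> Suc j mod n = i" "k = i \<or> Suc k mod n = i"
    using vertex_in_edge[OF assms(1,2)] j k by (auto simp: x_def n_def)
  have ends: "vs ! l = x \<or> next_vertex vs l = x" if "l = i \<or> Suc l mod n = i" for l
    using that by (auto simp: x_def n_def)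
  \<comment> \<open>A vertex is an endpoint, hence an extreme point, of each of its edges and so
    never strictly between two points of one of them.\<close>
  have "j \<noteq> k"
  proof
    assume "j = k"
    have "x extreme_point_of edge vs j"
      using ends[OF jk(1)] by (auto simp: edge_def extreme_point_of_segment)
    moreover have "x \<in> open_segment (x + s *\<^sub>R (- u)) (x + t *\<^sub>R u)"
    proof -
      have "x = (1 - s / (s + t)) *\<^sub>R (x + s *\<^sub>R (- u)) + (s / (s + t)) *\<^sub>R (x + t *\<^sub>R u)"
      proof -
        have "(s / (s + t)) * t = (1 - s / (s + t)) * s" using j k by (simp add: field_simps)
        then show ?thesis by (simp add: algebra_simps flip: scaleR_add_left)
      qed
      moreover have "0 < s / (s + t)" "s / (s + t) < 1" using j k by auto
      moreover have "x + s *\<^sub>R (- u) \<noteq> x + t *\<^sub>R u"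
      proof
        assume "x + s *\<^sub>R (- u) = x + t *\<^sub>R u"
        then have "(s + t) *\<^sub>R u = 0" by (simp add: algebra_simps)
        then show False using j k assms by simp
      qed
      ultimately show ?thesis by (auto simp: in_segment)
    qed
    ultimately show False
      using j k \<open>j = k\<close> by (auto simp: extreme_point_of_def)
  qed
  have par: "\<exists>c. vs ! l - x = c *\<^sub>R u \<and> next_vertex vs l - x = d *\<^sub>R u \<or>
      (\<exists>c d. vs ! l - x = c *\<^sub>R u \<and> next_vertex vs l - x = d *\<^sub>R u)"
    if l: "l = i \<or> Suc l mod n = i" "r \<noteq> 0" "x + r *\<^sub>R u \<in> edge vs l" for l r d
  proof -
    obtain a where a: "x + r *\<^sub>R u = (1 - a) *\<^sub>R (vs ! l) + a *\<^sub>R next_vertex vs l"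
      using l(3) by (auto simp: edge_def in_segment)
    have ru: "r *\<^sub>R u \<noteq> 0" using l(2) assms by simp
    show ?thesis
      using ends[OF l(1)]
    proof
      assume e: "vs ! l = x"
      then have eq: "r *\<^sub>R u = a *\<^sub>R (next_vertex vs l - x)" using a by (simp add: algebra_simps)
      then have "a \<noteq> 0" using ru by auto
      then have "next_vertex vs l - x = (r / a) *\<^sub>R u"
        using eq by (metis divideR_right divide_inverse_commute scaleR_scaleR)
      then show ?thesis using e by (metis cancel_comm_monoid_add_class.diff_cancel scaleR_zero_left)
    next
      assume e: "next_vertex vs l = x"
      then have eq: "r *\<^sub>R u = (1 - a) *\<^sub>R (vs ! l - x)" using a by (simp add: algebra_simps)
      then have "1 - a \<noteq> 0" using ru by auto
      then have "vs ! l - x = (r / (1 - a)) *\<^sub>R u"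
        using eq by (metis divideR_right divide_inverse_commute scaleR_scaleR)
      then show ?thesis using e by (metis cancel_comm_monoid_add_class.diff_cancel scaleR_zero_left)
    qed
  qed
  have par': "\<exists>c d. vs ! l - x = c *\<^sub>R u \<and> next_vertex vs l - x = d *\<^sub>R u" if "l = j \<or> l = k" for l
    using that par[OF jk(1), of "-s"] par[OF jk(2), of t] j k by auto
  \<comment> \<open>The two edges are the one ending and the one starting at \<open>vs ! i\<close>.
    As both are parallel to \<open>u\<close>, three consecutive vertices are collinear, which the
    definition of a polygon forbids.\<close>
  obtain l m where lm: "{l, m} = {j, k}" "Suc l mod n = i" "m = i"
    using jk \<open>j \<noteq> k\<close> j(1) k(1)
  proof -
    have inj: "l = m" if "Suc l mod n = Suc m mod n" "l < n" "m < n" for l m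
      using that by (auto simp: mod_Suc split: if_splits)
    show ?thesis
      using jk \<open>j \<noteq> k\<close> inj[of j k] j(1) k(1) that[of j k] that[of k j] by auto
  qed
  have ln: "l < n" using lm j k by (metis insertI1 insertE singletonD)
  have "\<exists>c. v - w = c *\<^sub>R u"
    if vw: "v \<in> {vs ! l, x, next_vertex vs i}" "w \<in> {vs ! l, x, next_vertex vs i}" for v w
  proof -
    have "\<exists>c. v - x = c *\<^sub>R u" if "v \<in> {vs ! l, x, next_vertex vs i}" for v
    proof -
      have "l = j \<or> l = k" "i = j \<or> i = k" using lm by blast+
      then show ?thesis using that par'[of l] par'[of i]
        by (auto intro: exI[of _ 0])
    qed
    then obtain c d where "v - x = c *\<^sub>R u" "w - x = d *\<^sub>R u" using vw by blast
    then have "v - w = (c - d) *\<^sub>R u" by (simp add: algebra_simps)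
    then show ?thesis by blast
  qed
  then have "collinear {vs ! l, x, next_vertex vs i}"
    unfolding collinear_def by blast
  moreover have "Suc i mod n = Suc (Suc l) mod n"
    using lm(2) by (metis mod_Suc_eq)
  ultimately have "collinear {vs ! l, vs ! (Suc l mod n), vs ! (Suc (Suc l) mod n)}"
    using lm(2) by (simp add: x_def n_def)
  then show False
    using assms(1) ln by (auto simp: polygon_with_vertices_def n_def)
qed

section \<open>The Jordan curve theorem for the boundary of a polygon\<close>

lemma polygon_Jordan:
  assumes "polygon_with_vertices P vs"
  defines "C \<equiv> (\<Union>i<length vs. edge vs i)"
  shows "compact C" "P = C \<union> inside C" "- P = outside C" "inside C \<noteq> {}" "open (inside C)"
    "C \<subseteq> closure (inside C)" "C \<subseteq> closure (- P)" "frontier P = C" "compact P"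
proof -
  define p where "p = boundary_path vs"
  have simple: "simple_path p" "pathfinish p = pathstart p"
    using assms polygon_edges(2)[OF assms(1)]
    by (auto simp: polygon_with_vertices_def p_def boundary_path_ends)
  have C: "path_image p = C"
    using path_image_boundary_path[OF polygon_edges(2)[OF assms(1)]] by (simp add: p_def C_def)
  show "compact C" by (simp flip: C add: compact_simple_path_image simple(1))
  then have clbd: "closed C" "bounded C" by (auto simp: compact_imp_closed compact_imp_bounded)
  show P: "P = C \<union> inside C"
    using assms(1) C by (simp add: polygon_with_vertices_def p_def)
  then show P': "- P = outside C" by (auto simp: outside_inside)
  show op: "open (inside C)" by (simp add: open_inside clbd)
  \<comment> \<open>The boundary is a topological circle, so the Jordan-Brouwer theorems apply: its
    complement is disconnected, and every component of the complement has all of \<open>C\<close> as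
    its frontier.\<close>
  have "C homeomorphic sphere (0::complex) 1"
    using homeomorphic_simple_path_image_circle[OF simple, of 1 0] C by simp
  moreover have "sphere (0::complex) 1 homeomorphic sphere (0::real^2) 1"
    by (rule homeomorphic_spheres_gen) auto
  ultimately have hom: "C homeomorphic sphere (0::real^2) 1"
    using homeomorphic_trans by blast
  have "connected (outside C)" by (rule connected_outside) (auto simp: clbd)
  moreover have "outside C \<noteq> {}" using unbounded_outside[of C] clbd by auto
  ultimately have "outside C \<in> components (- C)" by (simp add: outside_in_components)
  then have fr: "frontier (outside C) = C"
    using Jordan_Brouwer_frontier[OF hom] by simp
  show "C \<subseteq> closure (- P)" unfolding P' using fr by (auto simp: frontier_def)
  show "frontier P = C" using fr P' frontier_complement[of P] by simp
  show ne: "inside C \<noteq> {}"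
  proof
    assume "inside C = {}"
    then have "- C = outside C" using inside_Un_outside[of C] by simp
    then show False
      using Jordan_Brouwer_separation[OF hom] \<open>connected (outside C)\<close> by simp
  qed
  then obtain x where x: "x \<in> inside C" by blast
  \<comment> \<open>A single component suffices: its frontier is \<open>C\<close>, and it lies in
    \<open>inside C\<close>.\<close>
  define T where "T = connected_component_set (- C) x"
  have "x \<in> - C" using x by (auto simp: inside_def)
  then have "T \<in> components (- C)" by (auto simp: T_def components_def)
  then have "frontier T = C"
    using Jordan_Brouwer_frontier[OF hom] by simp
  moreover have "T \<subseteq> inside C" using x inside_same_component by (auto simp: T_def)
  ultimately show "C \<subseteq> closure (inside C)"
    using closure_mono[of T "inside C"] by (auto simp: frontier_def)
  have "closed P"
    using open_outside[OF clbd(1)] P' by (simp add: closed_def)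
  moreover have "bounded P" using clbd by (simp add: P bounded_inside)
  ultimately show "compact P" by (simp add: compact_eq_bounded_closed)
qed

text \<open>Both lists have the same union of edges, namely \<open>frontier P\<close>. A point of an
  edge of \<open>ws\<close> other than its ends is the midpoint of a boundary segment, which
  \<open>vertex_not_inner\<close> excludes for a vertex of \<open>vs\<close>.\<close>

lemma polygon_vertices_unique:
  assumes "polygon_with_vertices P vs" "polygon_with_vertices P ws"
  shows "set vs \<subseteq> set ws"
proof
  fix x assume "x \<in> set vs"
  then obtain i where i: "i < length vs" "x = vs ! i" by (auto simp: in_set_conv_nth)
  have C: "(\<Union>i<length vs. edge vs i) = (\<Union>i<length ws. edge ws i)"
    using polygon_Jordan(8)[OF assms(1)] polygon_Jordan(8)[OF assms(2)] by simp
  have "x \<in> (\<Union>i<length vs. edge vs i)" using i by (auto simp: edge_def)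
  then obtain j where j: "j < length ws" "x \<in> edge ws j" unfolding C by blast
  show "x \<in> set ws"
  proof (rule ccontr)
    assume "x \<notin> set ws"
    moreover have "ws ! j \<in> set ws" "next_vertex ws j \<in> set ws"
      using j by (auto intro!: nth_mem) (metis length_pos_if_in_set length_greater_0_conv mod_less_divisor not_less_zero nth_mem polygon_edges(2)[OF assms(2)])
    ultimately have ne: "x \<noteq> ws ! j" "x \<noteq> next_vertex ws j" by auto
    define a b where "a = ws ! j" and "b = next_vertex ws j"
    obtain t where t: "0 \<le> t" "t \<le> 1" "x = (1 - t) *\<^sub>R a + t *\<^sub>R b"
      using j(2) by (auto simp: edge_def in_segment a_def b_def)
    then have t01: "0 < t" "t < 1" and ab: "a \<noteq> b"
      using ne by (cases "t = 0"; cases "t = 1"; auto simp: a_def b_def algebra_simps)+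
    \<comment> \<open>The largest step for which both \<open>x - u\<close> and \<open>x + u\<close>
      stay on the edge.\<close>
    define s where "s = min t (1 - t)"
    define u where "u = s *\<^sub>R (b - a)"
    have "x - u = (1 - (t - s)) *\<^sub>R a + (t - s) *\<^sub>R b" "x + u = (1 - (t + s)) *\<^sub>R a + (t + s) *\<^sub>R b"
      by (auto simp: t(3) u_def algebra_simps)
    moreover have "0 \<le> t - s" "t - s \<le> 1" "0 \<le> t + s" "t + s \<le> 1" using t01 by (auto simp: s_def)
    ultimately have "x - u \<in> edge ws j" "x + u \<in> edge ws j"
      unfolding edge_def a_def[symmetric] b_def[symmetric] in_segment by blast+
    then have "closed_segment (x - u) (x + u) \<subseteq> edge ws j"
      by (simp add: edge_def closed_segment_subset)
    also have "\<dots> \<subseteq> (\<Union>i<length vs. edge vs i)" using j C by auto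
    finally have "closed_segment (x - u) (x + u) \<subseteq> (\<Union>i<length vs. edge vs i)" .
    moreover have "s \<noteq> 0" using t01 by (auto simp: s_def)
    then have "u \<noteq> 0" using ab by (simp add: u_def)
    ultimately show False
      using vertex_not_inner[OF assms(1) i(1), of u] i(2) by blast
  qed
qed

section \<open>Affine images and crossing parity\<close>

text \<open>Components of the complement go to components of the complement, and the boundedness
  hypotheses keep bounded ones bounded. The converse inclusion is the same argument for the inverse
  \<open>g\<close>.\<close>

lemma inside_homeomorphism_image:
  fixes f g :: "'a::real_normed_vector \<Rightarrow> 'a"
  assumes hom: "homeomorphism UNIV UNIV f g"
    and bd: "\<And>S. bounded S \<Longrightarrow> bounded (f ` S)" "\<And>S. bounded S \<Longrightarrow> bounded (g ` S)"
  shows "inside (f ` S) = f ` inside S"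
proof -
  have sub: "f ` inside S \<subseteq> inside (f ` S)"
    if hom: "homeomorphism UNIV UNIV f g" and bd: "\<And>S. bounded S \<Longrightarrow> bounded (f ` S)"
    for f g :: "'a \<Rightarrow> 'a" and S
  proof
    fix y assume "y \<in> f ` inside S"
    then obtain x where x: "y = f x" "x \<notin> S" "bounded (connected_component_set (- S) x)"
      by (auto simp: inside_def)
    have bij: "bij f" and inj: "inj f"
      using hom unfolding homeomorphism_def by (metis bij_betw_byWitness subset_UNIV UNIV_I)
        (metis hom homeomorphism_def inj_on_inverseI)
    have im: "f ` (- S) = - f ` S" by (simp add: bij bij_image_Compl_eq)
    have "homeomorphism (- S) (- f ` S) f g"
      using homeomorphism_of_subsets[OF hom, of "- S" "- f ` S"] im by simp
    then have "connected_component_set (- f ` S) (f x) = f ` connected_component_set (- S) x"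
      using connected_component_set_homeomorphism x(2) by blast
    moreover have "f x \<notin> f ` S" using x(2) inj by (simp add: inj_image_mem_iff)
    ultimately show "y \<in> inside (f ` S)" using x bd by (simp add: inside_def)
  qed
  have "g ` inside (f ` S) \<subseteq> inside (g ` f ` S)"
    by (rule sub[OF homeomorphism_symD[OF hom] bd(2)])
  moreover have "g ` f ` S = S" using hom by (auto simp: homeomorphism_def image_image)
  ultimately have "f ` g ` inside (f ` S) \<subseteq> f ` inside S" by (metis image_mono)
  moreover have "f ` g ` inside (f ` S) = inside (f ` S)"
    using hom by (auto simp: homeomorphism_def image_image)
  ultimately show ?thesis using sub[OF hom bd(1), of S] by auto
qed

lemma polygonal_path_affine:
  fixes A :: "real^2^2"
  assumes "vs \<noteq> []"
  shows "polygonal_path (map (\<lambda>x. A *v x + b) vs) = (\<lambda>x. A *v x + b) \<circ> polygonal_path vs"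
  using assms
proof (induction vs rule: polygonal_path.induct)
  have line: "linepath (A *v u + b) (A *v v + b) = (\<lambda>x. A *v x + b) \<circ> linepath u v" for u v
    by (auto simp: linepath_def fun_eq_iff matrix_vector_right_distrib
        matrix_vector_mult_scaleR algebra_simps)
  {
    case (2 a)
    then show ?case using line by simp
  next
    case (3 a b)
    then show ?case using line by simp
  next
    case (4 a b c xs)
    then show ?case using line by (simp add: path_compose_join del: o_apply)
  }
qed auto

lemma matrix_inv_mult:
  fixes A :: "real^'n^'n"
  assumes "invertible A"
  shows "A ** matrix_inv A = mat 1" "matrix_inv A ** A = mat 1"
  using someI_ex[OF assms[unfolded invertible_def]] by (auto simp: matrix_inv_def)

lemma affine_homeomorphism:
  fixes A :: "real^'n^'n"
  assumes "invertible A"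
  shows "homeomorphism UNIV UNIV (\<lambda>x. A *v x + b) (\<lambda>x. matrix_inv A *v (x - b))"
proof (rule homeomorphismI)
  have "A ** matrix_inv A = mat 1" "matrix_inv A ** A = mat 1"
    using assms by (auto simp: matrix_inv_mult)
  then show "matrix_inv A *v (A *v x + b - b) = x" "A *v (matrix_inv A *v (x - b)) + b = x" for x
    by (simp_all add: matrix_vector_mul_assoc)
qed (auto intro!: continuous_intros linear_continuous_on_compose[OF _ matrix_vector_mul_linear])

lemma inj_affine:
  fixes A :: "real^'n^'n"
  assumes "invertible A"
  shows "inj (\<lambda>x. A *v x + b)"
  using affine_homeomorphism[OF assms, of b] by (metis homeomorphism_def inj_on_inverseI)

lemma bounded_affine_image:
  fixes A :: "real^'n^'n"
  assumes "bounded S"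
  shows "bounded ((\<lambda>x. A *v x + b) ` S)"
proof -
  have "bounded ((+) b ` (*v) A ` S)"
    using assms by (intro bounded_translation bounded_linear_image) (auto simp: matrix_vector_mul_bounded_linear)
  then show ?thesis by (simp add: image_image add.commute)
qed

text \<open>Each clause of the definition is affinely invariant: simplicity by injectivity, the
  inside by \<open>inside_homeomorphism_image\<close>, and a collinearity of images pulls back along
  \<open>matrix_inv A\<close>.\<close>

lemma polygon_affine_image:
  assumes A: "invertible A" and P: "polygon_with_vertices P vs"
  shows "polygon_with_vertices ((\<lambda>x. A *v x + b) ` P) (map (\<lambda>x. A *v x + b) vs)"
proof -
  define T where "T = (\<lambda>x. A *v x + b)"
  have vs: "vs \<noteq> []" "3 \<le> length vs" using polygon_edges[OF P] by auto
  have path: "boundary_path (map T vs) = T \<circ> boundary_path vs"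
    using polygonal_path_affine[of "vs @ [hd vs]" A b] vs
    by (simp add: boundary_path_def T_def hd_map)
  have T: "T = (\<lambda>x. b + x) \<circ> (*v) A" by (auto simp: T_def)
  have injA: "inj ((*v) A)"
    using inj_affine[OF A, of 0] by simp
  have simple: "simple_path (T \<circ> boundary_path vs)"
    using P injA unfolding T comp_assoc simple_path_translation_eq
    by (simp add: simple_path_linear_image_eq polygon_with_vertices_def)
  have img: "path_image (T \<circ> p) = T ` path_image p" for p by (simp add: path_image_def image_comp)
  have bd: "bounded ((\<lambda>x. matrix_inv A *v (x - b)) ` S)" if "bounded S" for S
    using bounded_affine_image[OF that, of "matrix_inv A" "- (matrix_inv A *v b)"]
    by (simp add: matrix_vector_mult_diff_distrib)
  have inside: "inside (T ` S) = T ` inside S" for S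
    unfolding T_def using affine_homeomorphism[OF A] bounded_affine_image bd
    by (rule inside_homeomorphism_image)
  have coll: "collinear {u, v, w}" if coll: "collinear {T u, T v, T w}" for u v w
  proof -
    obtain d where d: "\<forall>x\<in>{T u, T v, T w}. \<forall>y\<in>{T u, T v, T w}. \<exists>c. x - y = c *\<^sub>R d"
      using coll unfolding collinear_def by blast
    have "\<exists>c. x - y = c *\<^sub>R (matrix_inv A *v d)" if xy: "x \<in> {u, v, w}" "y \<in> {u, v, w}" for x y
    proof -
      have "T x \<in> {T u, T v, T w}" "T y \<in> {T u, T v, T w}" using xy by blast+
      then obtain c where "T x - T y = c *\<^sub>R d" using d by blast
      then have "A *v (x - y) = c *\<^sub>R d" by (simp add: T_def matrix_vector_mult_diff_distrib)
      then have "matrix_inv A *v (A *v (x - y)) = c *\<^sub>R (matrix_inv A *v d)"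
        by (simp add: matrix_vector_mult_scaleR)
      then show ?thesis
        using A by (auto simp: matrix_vector_mul_assoc matrix_inv_mult)
    qed
    then show ?thesis unfolding collinear_def by blast
  qed
  have nxt: "i < length vs \<Longrightarrow> map T vs ! (k mod length vs) = T (vs ! (k mod length vs))" for i k
    using vs by (intro nth_map mod_less_divisor) auto
  show ?thesis
    unfolding T_def[symmetric] polygon_with_vertices_def
  proof (intro conjI allI impI)
    show "simple_path (boundary_path (map T vs))" by (simp add: path simple)
    show "T ` P = path_image (boundary_path (map T vs)) \<union> inside (path_image (boundary_path (map T vs)))"
      using P unfolding path img inside by (auto simp: polygon_with_vertices_def)
    show "\<not> collinear {map T vs ! i, map T vs ! (Suc i mod length (map T vs)),
        map T vs ! (Suc (Suc i) mod length (map T vs))}" if "i < length (map T vs)" for i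
      using that P coll[of "vs ! i"] by (auto simp: nxt polygon_with_vertices_def)
  qed (use vs in simp)
qed

section \<open>The planar determinant; for nonzero \<open>u\<close> the level lines of
  \<open>det2 u\<close> are the parallels to \<open>u\<close>\<close>

definition det2 :: "real^2 \<Rightarrow> real^2 \<Rightarrow> real" where
  "det2 u v = u $ 1 * v $ 2 - u $ 2 * v $ 1"

lemma det2_simps [simp]:
  "det2 (u + v) w = det2 u w + det2 v w" "det2 w (u + v) = det2 w u + det2 w v"
  "det2 (u - v) w = det2 u w - det2 v w" "det2 w (u - v) = det2 w u - det2 w v"
  "det2 (c *\<^sub>R u) w = c * det2 u w" "det2 w (c *\<^sub>R u) = c * det2 w u"
  "det2 (- u) w = - det2 u w" "det2 w (- u) = - det2 w u"
  "det2 u u = 0" "det2 0 u = 0" "det2 u 0 = 0"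
  by (auto simp: det2_def algebra_simps)

lemma det2_commute: "det2 u v = - det2 v u"
  by (simp add: det2_def)

lemma det2_matrix: "det2 (A *v u) (A *v v) = det A * det2 u v"
  by (simp add: det2_def det_2 matrix_vector_mult_def sum_2 algebra_simps)

lemma det2_eq_inner: "det2 u v = vector [- (u $ 2), u $ 1] \<bullet> v"
  by (simp add: det2_def inner_vec_def sum_2)

lemma det2_zero_imp_parallel:
  assumes "det2 u v = 0"
  shows "parallel u v"
proof (cases "u = 0")
  case False
  then obtain k where k: "u $ k \<noteq> 0" by (auto simp: vec_eq_iff)
  have "\<forall>j. v $ j * u $ k = v $ k * u $ j"
    using assms k exhaust_2[of k] by (auto simp: det2_def forall_2 algebra_simps)
  then have "v = (v $ k / u $ k) *\<^sub>R u"
    using k by (auto simp: vec_eq_iff field_simps)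
  then show ?thesis unfolding parallel_def collinear_lemma by blast
qed (simp add: parallel_def collinear_lemma)

lemma edges_not_parallel:
  assumes "no_parallel_edges vs" "i < length vs" "j < length vs" "i \<noteq> j"
  shows "det2 (next_vertex vs i - vs ! i) (next_vertex vs j - vs ! j) \<noteq> 0"
  using assms det2_zero_imp_parallel unfolding no_parallel_edges_def by blast

lemma edge_det2:
  assumes "x \<in> edge vs i"
  shows "det2 (next_vertex vs i - vs ! i) (x - vs ! i) = 0"
proof -
  obtain t where "x = (1 - t) *\<^sub>R vs ! i + t *\<^sub>R next_vertex vs i"
    using assms by (auto simp: edge_def in_segment)
  then have "x - vs ! i = t *\<^sub>R (next_vertex vs i - vs ! i)" by (simp add: algebra_simps)
  then show ?thesis by simp
qed

section \<open>Parity of the boundary crossings along a transversal line\<close>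

lemma crossing_once:
  assumes "x + s *\<^sub>R d \<in> edge vs i" "x + t *\<^sub>R d \<in> edge vs i"
    "det2 (next_vertex vs i - vs ! i) d \<noteq> 0"
  shows "s = t"
proof -
  have "(s - t) * det2 (next_vertex vs i - vs ! i) d = 0"
    using edge_det2[OF assms(1)] edge_det2[OF assms(2)] by (simp add: algebra_simps)
  then show ?thesis using assms(3) by simp
qed

lemma no_crossing:
  assumes "polygon_with_vertices P vs" "a \<le> b"
    "\<And>t. a \<le> t \<Longrightarrow> t \<le> b \<Longrightarrow> x + t *\<^sub>R d \<notin> (\<Union>i<length vs. edge vs i)"
  shows "x + a *\<^sub>R d \<in> P \<longleftrightarrow> x + b *\<^sub>R d \<in> P"
proof -
  let ?S = "(\<lambda>t. x + t *\<^sub>R d) ` {a..b}"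
  have "connected ?S"
    by (intro connected_continuous_image continuous_intros) auto
  moreover have "?S \<inter> frontier P = {}"
    unfolding polygon_Jordan(8)[OF assms(1)] using assms(3) by auto
  ultimately have "?S \<subseteq> P \<or> ?S \<inter> P = {}"
    using connected_Int_frontier[of ?S P] by blast
  moreover have "x + a *\<^sub>R d \<in> ?S" "x + b *\<^sub>R d \<in> ?S" using assms(2) by auto
  ultimately show ?thesis by blast
qed

text \<open>In a small disc around \<open>w\<close> the boundary lies on one line, so each of the
  two open half discs lies entirely in \<open>P\<close> or entirely outside. As \<open>w\<close> is
  a limit both of points of \<open>inside C\<close> and of points of \<open>- P\<close>, one half
  disc is of either kind.\<close>

lemma crossing_flips:
  assumes P: "polygon_with_vertices P vs" and i: "i < length vs" "w \<in> edge vs i"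
    and other: "\<And>j. j < length vs \<Longrightarrow> j \<noteq> i \<Longrightarrow> w \<notin> edge vs j"
    and d: "det2 (next_vertex vs i - vs ! i) d \<noteq> 0"
  shows "\<exists>\<epsilon>>0. \<forall>s t. 0 < s \<longrightarrow> s < \<epsilon> \<longrightarrow> 0 < t \<longrightarrow> t < \<epsilon> \<longrightarrow> (w - s *\<^sub>R d \<in> P \<longleftrightarrow> w + t *\<^sub>R d \<notin> P)"
proof -
  define e where "e = next_vertex vs i - vs ! i"
  have ed: "det2 e d \<noteq> 0" using d unfolding e_def .
  define C where "C = (\<Union>i<length vs. edge vs i)"
  note J = polygon_Jordan[OF P, folded C_def]
  have line: "det2 e (z - w) = 0" if "z \<in> edge vs i" for z
    using edge_det2[OF that] edge_det2[OF i(2)] by (simp add: e_def)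
  define K where "K = (\<Union>j\<in>{..<length vs} - {i}. edge vs j)"
  have "closed K" "w \<notin> K" using other by (auto simp: K_def edge_def intro!: closed_UN)
  then obtain r where r: "r > 0" "ball w r \<subseteq> - K"
    using openE[of "- K" w] by (auto simp: open_Compl)
  have CB: "det2 e (z - w) = 0" if "z \<in> C" "z \<in> ball w r" for z
    using that r line unfolding C_def K_def by blast
  \<comment> \<open>Only the sign of \<open>s\<close> matters: opposite signs give the two open half
    discs.\<close>
  define H where "H s = ball w r \<inter> {z. 0 < s * det2 e (z - w)}" for s :: real
  have lin: "det2 e (z - w) = vector [- (e $ 2), e $ 1] \<bullet> z - det2 e w" for z
    by (simp flip: det2_eq_inner)
  have side: "H s \<subseteq> P \<or> H s \<inter> P = {}" for s
  proof -
    have "{z. 0 < s * det2 e (z - w)} =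
        {z. (s *\<^sub>R vector [- (e $ 2), e $ 1]) \<bullet> z > s * det2 e w}"
      unfolding lin by (auto simp: algebra_simps)
    then have "convex (H s)"
      unfolding H_def by (metis convex_Int convex_ball convex_halfspace_gt)
    moreover have "H s \<inter> frontier P = {}"
      unfolding J(8) using CB by (force simp: H_def)
    ultimately show ?thesis
      using connected_Int_frontier[of "H s" P] convex_connected by blast
  qed
  have H: "w + t *\<^sub>R d \<in> H (s * det2 e d)" if "0 < s * t" "\<bar>t\<bar> * norm d < r" for s t
  proof -
    have "0 < (s * t) * (det2 e d * det2 e d)"
      using mult_pos_pos[OF that(1)] ed by (metis not_real_square_gt_zero)
    then show ?thesis using that(2) by (simp add: H_def dist_norm mult.assoc mult.left_commute)
  qed
  have dn: "d \<noteq> 0" using d by auto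
  \<comment> \<open>An open set that accumulates at \<open>w\<close> reaches one of the half discs:
    a point on the line of the edge is pushed off it along \<open>d\<close>.\<close>
  have off: "\<exists>z\<in>U. z \<in> H (det2 e d) \<or> z \<in> H (- det2 e d)"
    if U: "open U" "w \<in> closure U" for U
  proof -
    obtain z where z: "z \<in> U \<inter> ball w r"
      using U r by (metis centre_in_ball closure_iff_nhds_not_empty disjoint_iff open_ball order_refl IntI)
    have "open (U \<inter> ball w r)" using U by auto
    then obtain q where q: "q > 0" "ball z q \<subseteq> U \<inter> ball w r" using z openE by blast
    define \<delta> where "\<delta> = q / (2 * norm d)"
    have \<delta>: "\<delta> > 0" "\<delta> * norm d < q" using q dn by (auto simp: \<delta>_def)
    define z' where "z' = (if det2 e (z - w) = 0 then z + \<delta> *\<^sub>R d else z)"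
    have "z' \<in> U \<inter> ball w r" using q \<delta> z by (auto simp: z'_def dist_norm subset_iff)
    moreover have "det2 e (z' - w) \<noteq> 0" using \<delta> ed by (auto simp: z'_def)
    then have "det2 e d * det2 e (z' - w) \<noteq> 0" using ed by (simp del: det2_simps)
    then have "0 < det2 e d * det2 e (z' - w) \<or> 0 < - det2 e d * det2 e (z' - w)"
      by (metis linorder_neqE_linordered_idom mult_minus_left neg_0_less_iff_less)
    ultimately show ?thesis
      unfolding H_def by blast
  qed
  have w: "w \<in> C" using i by (auto simp: C_def)
  obtain z1 where z1: "z1 \<in> P" "z1 \<in> H (det2 e d) \<or> z1 \<in> H (- det2 e d)"
    using off[of "inside C"] J w by blast
  obtain z2 where z2: "z2 \<notin> P" "z2 \<in> H (det2 e d) \<or> z2 \<in> H (- det2 e d)"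
  proof -
    have "open (- P)" using J(9) compact_imp_closed by blast
    moreover have "w \<in> closure (- P)" using J(7) w by blast
    ultimately show ?thesis using off[of "- P"] that by blast
  qed
  have "w - s *\<^sub>R d \<in> P \<longleftrightarrow> w + t *\<^sub>R d \<notin> P" if "0 < s" "s < r / norm d" "0 < t" "t < r / norm d" for s t
  proof -
    have "w + (- s) *\<^sub>R d \<in> H ((-1) * det2 e d)" "w + t *\<^sub>R d \<in> H (1 * det2 e d)"
      using H[of "-1" "- s"] H[of 1 t] that dn by (simp_all add: pos_less_divide_eq)
    then show ?thesis using z1 z2 side[of "det2 e d"] side[of "- det2 e d"] by auto
  qed
  then show ?thesis using r dn by (intro exI[of _ "r / norm d"]) auto
qed

text \<open>Strong induction on the number of edges crossed: a single crossing is
  \<open>crossing_flips\<close>, and several are separated by cutting the path between two of them.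
  Avoiding the vertices makes distinct edges be crossed at distinct parameters; transversality lets
  each edge be crossed only once.\<close>

lemma crossing_parity:
  assumes P: "polygon_with_vertices P vs"
    and nz: "\<And>i. i < length vs \<Longrightarrow> det2 (next_vertex vs i - vs ! i) d \<noteq> 0"
    and "a < b"
    and "x + a *\<^sub>R d \<notin> (\<Union>i<length vs. edge vs i)" "x + b *\<^sub>R d \<notin> (\<Union>i<length vs. edge vs i)"
    and "\<And>t. a \<le> t \<Longrightarrow> t \<le> b \<Longrightarrow> x + t *\<^sub>R d \<notin> set vs"
  shows "(x + a *\<^sub>R d \<in> P \<longleftrightarrow> x + b *\<^sub>R d \<in> P) \<longleftrightarrow>
    even (card {i. i < length vs \<and> (\<exists>t. a \<le> t \<and> t \<le> b \<and> x + t *\<^sub>R d \<in> edge vs i)})"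
  using assms(3-)
proof (induction "card {i. i < length vs \<and> (\<exists>t. a \<le> t \<and> t \<le> b \<and> x + t *\<^sub>R d \<in> edge vs i)}"
    arbitrary: a b rule: less_induct)
  case (less a b)
  define X where "X a b = {i. i < length vs \<and> (\<exists>t. a \<le> t \<and> t \<le> b \<and> x + t *\<^sub>R d \<in> edge vs i)}" for a b
  define C where "C = (\<Union>i<length vs. edge vs i)"
  have fin: "finite (X a b)" for a b by (simp add: X_def)
  have once: "s = t" if "x + s *\<^sub>R d \<in> edge vs i" "x + t *\<^sub>R d \<in> edge vs i" "i < length vs" for i s t
    using crossing_once nz that by blast
  have ends: "x + a *\<^sub>R d \<notin> C" "x + b *\<^sub>R d \<notin> C" using less.prems by (auto simp: C_def)
  consider "X a b = {}" | i where "X a b = {i}" | i j where "i \<in> X a b" "j \<in> X a b" "i \<noteq> j"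
    by blast
  then show ?case
  proof cases
    case 1
    then have "x + a *\<^sub>R d \<in> P \<longleftrightarrow> x + b *\<^sub>R d \<in> P"
      using less.prems by (intro no_crossing[OF P]) (auto simp: X_def)
    then show ?thesis using 1 by (simp flip: X_def)
  next
    case (2 i)
    then obtain \<tau> where \<tau>: "a \<le> \<tau>" "\<tau> \<le> b" "x + \<tau> *\<^sub>R d \<in> edge vs i" and i: "i < length vs"
      by (auto simp: X_def)
    have only: "t = \<tau>" if t: "a \<le> t" "t \<le> b" "x + t *\<^sub>R d \<in> C" for t
    proof -
      obtain j where j: "j < length vs" "x + t *\<^sub>R d \<in> edge vs j" using t by (auto simp: C_def)
      then have "j \<in> X a b" using t by (auto simp: X_def)
      then show ?thesis using 2 j \<tau> once by auto
    qed
    have strict: "a < \<tau>" "\<tau> < b"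
      using \<tau> i ends by (auto simp: C_def less_le)
    obtain \<epsilon> where \<epsilon>: "\<epsilon> > 0" and flip: "\<And>s t. 0 < s \<Longrightarrow> s < \<epsilon> \<Longrightarrow> 0 < t \<Longrightarrow> t < \<epsilon> \<Longrightarrow>
        (x + \<tau> *\<^sub>R d) - s *\<^sub>R d \<in> P \<longleftrightarrow> (x + \<tau> *\<^sub>R d) + t *\<^sub>R d \<notin> P"
    proof -
      have "x + \<tau> *\<^sub>R d \<notin> edge vs j" if "j < length vs" "j \<noteq> i" for j
        using 2 \<tau> that by (auto simp: X_def)
      from crossing_flips[OF P i \<tau>(3) this nz[OF i]] show ?thesis using that by blast
    qed
    \<comment> \<open>Small enough both for the local flip and for staying between \<open>a\<close>
      and \<open>b\<close>.\<close>
    define s where "s = min \<epsilon> (\<tau> - a) / 2"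
    define t where "t = min \<epsilon> (b - \<tau>) / 2"
    have s: "0 < s" "s < \<epsilon>" "a \<le> \<tau> - s" and t: "0 < t" "t < \<epsilon>" "\<tau> + t \<le> b"
      using \<epsilon> strict by (auto simp: s_def t_def min_def field_simps)
    have "x + u *\<^sub>R d \<notin> C" if "a \<le> u" "u \<le> \<tau> - s" for u
      using only[of u] that s strict by auto
    then have "x + a *\<^sub>R d \<in> P \<longleftrightarrow> x + (\<tau> - s) *\<^sub>R d \<in> P"
      using s(3) unfolding C_def by (rule no_crossing[OF P, rotated])
    moreover have "x + u *\<^sub>R d \<notin> C" if "\<tau> + t \<le> u" "u \<le> b" for u
      using only[of u] that t strict by auto
    then have "x + (\<tau> + t) *\<^sub>R d \<in> P \<longleftrightarrow> x + b *\<^sub>R d \<in> P"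
      using t(3) unfolding C_def by (rule no_crossing[OF P, rotated])
    moreover have "x + (\<tau> - s) *\<^sub>R d \<in> P \<longleftrightarrow> x + (\<tau> + t) *\<^sub>R d \<notin> P"
      using flip[of s t] s t by (simp add: algebra_simps)
    ultimately show ?thesis using 2 by (simp flip: X_def)
  next
    case (3 i j)
    have "\<exists>i j s t. i \<in> X a b \<and> j \<in> X a b \<and> s < t \<and> a \<le> s \<and> t \<le> b \<and>
        x + s *\<^sub>R d \<in> edge vs i \<and> x + t *\<^sub>R d \<in> edge vs j"
    proof -
      obtain s t where st: "a \<le> s" "s \<le> b" "x + s *\<^sub>R d \<in> edge vs i" "a \<le> t" "t \<le> b"
        "x + t *\<^sub>R d \<in> edge vs j"
        using 3 by (auto simp: X_def)
      have "s \<noteq> t"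
        using edges_meet_at_vertex[OF P, of i j "x + s *\<^sub>R d"] 3 st less.prems(4)[of s]
        by (auto simp: X_def)
      then show ?thesis using 3 st by (metis linorder_neqE_linordered_idom)
    qed
    then obtain i j s t where ij: "i \<in> X a b" "j \<in> X a b" "s < t" "a \<le> s" "t \<le> b"
        "x + s *\<^sub>R d \<in> edge vs i" "x + t *\<^sub>R d \<in> edge vs j" by blast
    have "finite {t. x + t *\<^sub>R d \<in> edge vs i}" if "i < length vs" for i
    proof (rule finite_subset)
      show "{t. x + t *\<^sub>R d \<in> edge vs i} \<subseteq> {SOME t. x + t *\<^sub>R d \<in> edge vs i}"
        using once[OF _ _ that] by (auto intro: someI2)
    qed simp
    then have "finite (\<Union>i<length vs. {t. x + t *\<^sub>R d \<in> edge vs i})" by blast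
    moreover have "{t. x + t *\<^sub>R d \<in> C} = (\<Union>i<length vs. {t. x + t *\<^sub>R d \<in> edge vs i})"
      by (auto simp: C_def)
    \<comment> \<open>Finitely many crossings cannot fill an interval, so there is a cut point off
      the boundary strictly between the two crossings.\<close>
    ultimately have "infinite ({s<..<t} - {t. x + t *\<^sub>R d \<in> C})"
      using ij by (simp add: Diff_infinite_finite)
    then have "{s<..<t} - {t. x + t *\<^sub>R d \<in> C} \<noteq> {}" by (rule infinite_imp_nonempty)
    then obtain c where "c \<in> {s<..<t} - {t. x + t *\<^sub>R d \<in> C}" by blast
    then have c: "s < c" "c < t" "x + c *\<^sub>R d \<notin> C" by auto
    have ac: "a < c" "c < b" using c ij by auto
    have un: "X a b = X a c \<union> X c b"
    proof -
      have "t \<in> {a..b} \<longleftrightarrow> t \<in> {a..c} \<or> t \<in> {c..b}" for t using ac by auto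
      then show ?thesis unfolding X_def by auto
    qed
    have dj: "X a c \<inter> X c b = {}"
    proof (rule ccontr)
      assume "X a c \<inter> X c b \<noteq> {}"
      then obtain k u v where k: "k < length vs" "u \<le> c" "c \<le> v" "x + u *\<^sub>R d \<in> edge vs k"
        "x + v *\<^sub>R d \<in> edge vs k" by (auto simp: X_def)
      then have "u = c" using once[OF k(4,5,1)] by simp
      then show False using k c by (auto simp: C_def)
    qed
    have "s \<le> c" "c \<le> t" using c by auto
    then have "i \<in> X a c" "j \<in> X c b" using ij unfolding X_def by blast+
    then have pos: "card (X a c) > 0" "card (X c b) > 0" using fin by (auto simp: card_gt_0_iff)
    have sum: "card (X a b) = card (X a c) + card (X c b)"
      unfolding un by (rule card_Un_disjoint[OF fin fin dj])
    have "(x + a *\<^sub>R d \<in> P \<longleftrightarrow> x + c *\<^sub>R d \<in> P) \<longleftrightarrow> even (card (X a c))"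
      using less.hyps[of a c] sum pos ac ends c less.prems(4) by (simp add: C_def flip: X_def)
    moreover have "(x + c *\<^sub>R d \<in> P \<longleftrightarrow> x + b *\<^sub>R d \<in> P) \<longleftrightarrow> even (card (X c b))"
      using less.hyps[of c b] sum pos ac ends c less.prems(4) by (simp add: C_def flip: X_def)
    ultimately show ?thesis
      unfolding X_def[symmetric] sum by auto
  qed
qed

section \<open>Integer points and translates of an edge\<close>

lemma integer_point_simps [simp]:
  "integer_point 0" "integer_point u \<Longrightarrow> integer_point (- u)"
  "integer_point u \<Longrightarrow> integer_point v \<Longrightarrow> integer_point (u + v)"
  "integer_point u \<Longrightarrow> integer_point v \<Longrightarrow> integer_point (u - v)"
  "integer_point u \<Longrightarrow> integer_point (of_int n *\<^sub>R u)"
  by (auto simp: integer_point_def)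

lemma integer_point_iff: "integer_point z \<longleftrightarrow> (\<exists>a b. z = vector [of_int a, of_int b])"
proof -
  have "z = vector [of_int a, of_int b] \<longleftrightarrow> z $ 1 = of_int a \<and> z $ 2 = of_int b" for a b
    by (simp add: vec_eq_iff forall_2)
  then show ?thesis
    unfolding integer_point_def forall_2 by (auto elim!: Ints_cases)
qed

lemma det2_integer: "integer_point u \<Longrightarrow> integer_point v \<Longrightarrow> det2 u v \<in> \<int>"
  by (simp add: det2_def integer_point_def)

lemma countable_integer_points: "countable {z. integer_point z}"
proof -
  have "{z. integer_point z} = (\<lambda>(a, b). vector [of_int a, of_int b]) ` (UNIV :: (int \<times> int) set)"
    by (auto simp: integer_point_iff)
  then show ?thesis by simp
qed

lemma finite_integer_points:
  assumes "bounded S"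
  shows "finite {z \<in> S. integer_point z}"
proof -
  obtain B where B: "\<And>z. z \<in> S \<Longrightarrow> norm z \<le> B" using assms by (auto simp: bounded_iff)
  have "{z \<in> S. integer_point z} \<subseteq>
      (\<lambda>(a, b). vector [of_int a, of_int b]) ` ({- \<lceil>B\<rceil>..\<lceil>B\<rceil>} \<times> {- \<lceil>B\<rceil>..\<lceil>B\<rceil>})"
  proof
    fix z assume "z \<in> {z \<in> S. integer_point z}"
    then obtain a b where z: "z \<in> S" "z = vector [of_int a, of_int b]" by (auto simp: integer_point_iff)
    have "\<bar>of_int a\<bar> \<le> B" "\<bar>of_int b\<bar> \<le> B"
      using component_le_norm_cart[of z 1] component_le_norm_cart[of z 2] B[OF z(1)] by (auto simp: z(2))
    then have "a \<in> {- \<lceil>B\<rceil>..\<lceil>B\<rceil>}" "b \<in> {- \<lceil>B\<rceil>..\<lceil>B\<rceil>}" by (auto simp: le_ceiling_iff abs_le_iff) linarith+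
    then show "z \<in> (\<lambda>(a, b). vector [of_int a, of_int b]) ` ({- \<lceil>B\<rceil>..\<lceil>B\<rceil>} \<times> {- \<lceil>B\<rceil>..\<lceil>B\<rceil>})"
      using z(2) by (intro image_eqI[of _ _ "(a, b)"]) auto
  qed
  then show ?thesis by (rule finite_subset) auto
qed

text \<open>Here \<open>d\<close> is the gcd of the coordinates, and Bezout coefficients provide
  \<open>q\<close>, so that \<open>p\<close> and \<open>q\<close> form a basis of the integer
  points. The clause on even \<open>d\<close> feeds the halving argument
  \<open>integer_polygon_halving\<close>.\<close>

lemma primitive_decomposition:
  assumes "integer_point e" "e \<noteq> 0"
  shows "\<exists>(d::int) p q. 0 < d \<and> integer_point p \<and> integer_point q \<and> det2 p q = 1 \<and>
    e = of_int d *\<^sub>R p \<and> (even d \<longrightarrow> (\<exists>f. integer_point f \<and> e = 2 *\<^sub>R f))"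
proof -
  obtain a b where e: "e = vector [of_int a, of_int b]" using assms by (auto simp: integer_point_iff)
  define d where "d = gcd a b"
  have d: "d > 0" using assms(2) by (auto simp: d_def e gcd_pos_int vec_eq_iff forall_2)
  obtain a' b' where ab: "a = d * a'" "b = d * b'"
    by (metis d_def dvd_def gcd_dvd1 gcd_dvd2)
  obtain u v where "u * a + v * b = d" using bezout_int[of a b] by (auto simp: d_def)
  then have "d * (u * a' + v * b') = d * 1" by (simp add: ab algebra_simps)
  then have uv: "u * a' + v * b' = 1" using d by simp
  define p q :: "real^2" where "p = vector [of_int a', of_int b']" and "q = vector [- of_int v, of_int u]"
  have "det2 p q = of_int (u * a' + v * b')" by (simp add: det2_def p_def q_def)
  then have "det2 p q = 1" by (simp only: uv of_int_1)
  moreover have "integer_point p" "integer_point q"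
    by (auto simp: p_def q_def integer_point_def forall_2)
  moreover have ep: "e = of_int d *\<^sub>R p" by (simp add: e p_def ab vec_eq_iff forall_2)
  moreover have "\<exists>f. integer_point f \<and> e = 2 *\<^sub>R f" if "even d"
  proof -
    from \<open>even d\<close> obtain k where "d = 2 * k" by auto
    then have "e = 2 *\<^sub>R (of_int k *\<^sub>R p)" by (simp add: ep)
    then show ?thesis using \<open>integer_point p\<close> integer_point_simps(5) by blast
  qed
  ultimately show ?thesis using d by blast
qed

section \<open>Counting the lattice translates of an edge that meet a segment\<close>

lemma basis_decomposition:
  assumes "det2 p q = 1"
  shows "w = det2 w q *\<^sub>R p + det2 p w *\<^sub>R q"
proof -
  have "w $ 1 * det2 p q = det2 w q * p $ 1 + det2 p w * q $ 1"
    "w $ 2 * det2 p q = det2 w q * p $ 2 + det2 p w * q $ 2"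
    by (auto simp: det2_def algebra_simps)
  then show ?thesis using assms by (simp add: vec_eq_iff forall_2)
qed

text \<open>The path meets each line \<open>det2 p w = j\<close>, for integers \<open>j\<close> in
  the range, exactly once, at \<open>w j = \<tau> j p + j q\<close>. As \<open>\<tau> j\<close> is
  not an integer, it lies between \<open>n\<close> and \<open>n + d\<close> for exactly
  \<open>d\<close> integers \<open>n\<close>.\<close>

lemma lattice_translates_crossing:
  fixes d :: int
  assumes d: "0 < d" and p: "integer_point p" "integer_point q" "det2 p q = 1"
    and less: "det2 p x < det2 p y" and nint: "det2 p x \<notin> \<int>"
    and off: "\<And>t. 0 \<le> t \<Longrightarrow> t \<le> 1 \<Longrightarrow> \<not> integer_point (x + t *\<^sub>R (y - x))"
  defines "Z \<equiv> {z. integer_point z \<and>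
      (\<exists>t. 0 \<le> t \<and> t \<le> 1 \<and> x + t *\<^sub>R (y - x) \<in> closed_segment z (z + of_int d *\<^sub>R p))}"
  shows "finite Z \<and> int (card Z) = d * (\<lfloor>det2 p y\<rfloor> - \<lfloor>det2 p x\<rfloor>)"
proof -
  define \<alpha> \<beta> where "\<alpha> = det2 p x" and "\<beta> = det2 p y"
  \<comment> \<open>The parameter at which the path reaches the line where \<open>det2 p\<close>
    equals \<open>j\<close>.\<close>
  define t where "t j = (of_int j - \<alpha>) / (\<beta> - \<alpha>)" for j :: int
  define w where "w j = x + t j *\<^sub>R (y - x)" for j :: int
  define \<tau> where "\<tau> j = det2 (w j) q" for j
  \<comment> \<open>These are the \<open>n\<close> with \<open>n \<le> \<tau> j < n + d\<close>. The
    closed segment would also allow \<open>\<tau> j = n + d\<close>, which is impossible for a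
    noninteger \<open>\<tau> j\<close>.\<close>
  define R where "R j = {\<lfloor>\<tau> j\<rfloor> - d + 1..\<lfloor>\<tau> j\<rfloor>}" for j
  \<comment> \<open>As \<open>\<alpha>\<close> is not an integer, starting at
    \<open>\<lfloor>\<alpha>\<rfloor> + 1\<close> loses no crossing.\<close>
  define J where "J = {\<lfloor>\<alpha>\<rfloor> + 1..\<lfloor>\<beta>\<rfloor>}"
  define f where "f = (\<lambda>(j::int, n::int). of_int n *\<^sub>R p + of_int j *\<^sub>R q)"
  have ab: "\<alpha> < \<beta>" "\<alpha> \<notin> \<int>" using less nint by (auto simp: \<alpha>_def \<beta>_def)
  have t01: "0 \<le> t j" "t j \<le> 1" if "j \<in> J" for j
    using that ab unfolding J_def t_def
    by (auto simp: field_simps le_floor_iff floor_less_iff) linarith+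
  have qp: "det2 q q = 0" "det2 p p = 0" "det2 q p = -1" using p(3) det2_commute[of q p] by auto
  have pw: "det2 p (w j) = of_int j" for j
  proof -
    have "det2 p (w j) = \<alpha> + t j * (\<beta> - \<alpha>)" by (simp add: w_def \<alpha>_def \<beta>_def)
    then show ?thesis using ab by (simp add: t_def)
  qed
  have wj: "w j = \<tau> j *\<^sub>R p + of_int j *\<^sub>R q" for j
    using basis_decomposition[OF p(3), of "w j"] by (simp add: \<tau>_def pw)
  have \<tau>: "\<tau> j \<notin> \<int>" if "j \<in> J" for j
  proof
    assume "\<tau> j \<in> \<int>"
    then have "integer_point (w j)" unfolding wj using p by (auto elim!: Ints_cases)
    then show False using off[OF t01[OF that]] by (simp add: w_def)
  qed
  have fdet: "det2 p (f (j, n)) = of_int j" "det2 (f (j, n)) q = of_int n" for j n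
    using p(3) by (auto simp: f_def)
  have inj: "inj_on f (Sigma J R)"
  proof (rule inj_onI)
    fix a b assume "f a = f b"
    then show "a = b" using fdet[of "fst a" "snd a"] fdet[of "fst b" "snd b"]
      by (simp add: prod_eq_iff)
  qed
  have "f ` Sigma J R = Z"
  proof (intro set_eqI iffI)
    fix z assume "z \<in> f ` Sigma J R"
    then obtain j n where jn: "z = f (j, n)" "j \<in> J" "n \<in> R j" by auto
    have "integer_point z" using p by (simp add: jn f_def)
    moreover have "w j \<in> closed_segment z (z + of_int d *\<^sub>R p)"
    proof -
      define u where "u = (\<tau> j - of_int n) / of_int d"
      have "0 \<le> u" "u \<le> 1" using jn(3) d by (auto simp: u_def R_def field_simps le_floor_iff) linarith+
      moreover have "w j = (1 - u) *\<^sub>R z + u *\<^sub>R (z + of_int d *\<^sub>R p)"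
      proof -
        have ud: "u * of_int d = \<tau> j - of_int n" using d by (simp add: u_def)
        have "(1 - u) *\<^sub>R z + u *\<^sub>R (z + of_int d *\<^sub>R p) = z + (u * of_int d) *\<^sub>R p"
          by (simp add: algebra_simps)
        also have "\<dots> = w j" unfolding ud by (simp add: wj jn(1) f_def algebra_simps)
        finally show ?thesis by simp
      qed
      ultimately show ?thesis unfolding in_segment by blast
    qed
    ultimately show "z \<in> Z" using t01[OF jn(2)] by (auto simp: Z_def w_def)
  next
    fix z assume "z \<in> Z"
    then obtain s where z: "integer_point z" and s: "0 \<le> s" "s \<le> 1"
      "x + s *\<^sub>R (y - x) \<in> closed_segment z (z + of_int d *\<^sub>R p)" by (auto simp: Z_def)
    then obtain u where u: "0 \<le> u" "u \<le> 1" "x + s *\<^sub>R (y - x) = z + (u * of_int d) *\<^sub>R p"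
      by (auto simp: in_segment algebra_simps)
    obtain n where n: "det2 z q = of_int n" using det2_integer[OF z p(2)] by (auto elim: Ints_cases)
    obtain j where j: "det2 p z = of_int j" using det2_integer[OF p(1) z] by (auto elim: Ints_cases)
    have zf: "z = f (j, n)" using basis_decomposition[OF p(3), of z] by (simp add: f_def n j)
    have "det2 p (x + s *\<^sub>R (y - x)) = of_int j" by (simp add: u(3) j qp)
    then have js: "of_int j = \<alpha> + s * (\<beta> - \<alpha>)" by (simp add: \<alpha>_def \<beta>_def)
    then have "s = t j" using ab by (simp add: t_def)
    then have wz: "w j = z + (u * of_int d) *\<^sub>R p" using u(3) by (simp add: w_def)
    have "0 \<le> s * (\<beta> - \<alpha>)" "s * (\<beta> - \<alpha>) \<le> \<beta> - \<alpha>"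
      using s(1,2) ab by (auto intro: mult_left_le_one_le)
    then have "\<alpha> \<le> of_int j" "of_int j \<le> \<beta>" using js by linarith+
    moreover have "\<alpha> \<noteq> of_int j" using ab by auto
    ultimately have jJ: "j \<in> J"
      by (auto simp: J_def le_floor_iff) (metis floor_less_iff less_le zless_imp_add1_zle)
    have "\<tau> j = of_int n + u * of_int d" using p(3) by (simp add: \<tau>_def wz n)
    moreover have "0 \<le> u * of_int d" "u * of_int d \<le> of_int d"
      using u d by (auto simp: mult_left_le_one_le)
    ultimately have "of_int n \<le> \<tau> j" "\<tau> j \<le> of_int (n + d)" by auto
    moreover have "\<tau> j \<noteq> of_int (n + d)" using \<tau>[OF jJ] by auto
    ultimately have "n \<in> R j"
      by (auto simp: R_def le_floor_iff) (metis floor_less_iff less_le of_int_add zle_add1_eq_le add_diff_cancel_right' diff_add_eq le_diff_eq)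
    then show "z \<in> f ` Sigma J R" using jJ zf by blast
  qed
  moreover have "finite (Sigma J R)" by (auto simp: J_def R_def)
  moreover have "card (Sigma J R) = (\<Sum>j\<in>J. card (R j))" by (rule card_SigmaI) (auto simp: J_def R_def)
  then have "int (card (Sigma J R)) = d * (\<lfloor>\<beta>\<rfloor> - \<lfloor>\<alpha>\<rfloor>)"
    using d ab by (simp add: R_def J_def floor_mono algebra_simps)
  ultimately show ?thesis
    using card_image[OF inj] by (auto simp: \<alpha>_def \<beta>_def)
qed

text \<open>Modulo 2 the sign of the difference of floors is irrelevant, so the segment may run in
  either direction: reversing it swaps \<open>x\<close> and \<open>y\<close>. The integer offset
  \<open>v\<close> merely reindexes the translates.\<close>

lemma lattice_translates_crossing_parity:
  fixes d :: int
  assumes d: "0 < d" and p: "integer_point p" "integer_point q" "det2 p q = 1"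
    and v: "integer_point v"
    and ne: "det2 p (y - x) \<noteq> 0" and nint: "det2 p x \<notin> \<int>" "det2 p y \<notin> \<int>"
    and off: "\<And>t. 0 \<le> t \<Longrightarrow> t \<le> 1 \<Longrightarrow> \<not> integer_point (x + t *\<^sub>R (y - x))"
  defines "Z \<equiv> {z. integer_point z \<and>
      (\<exists>t. 0 \<le> t \<and> t \<le> 1 \<and> x + t *\<^sub>R (y - x) \<in> closed_segment (z + v) (z + v + of_int d *\<^sub>R p))}"
  shows "finite Z \<and> even (int (card Z) - d * (\<lfloor>det2 p x\<rfloor> - \<lfloor>det2 p y\<rfloor>))"
proof -
  define Z0 where "Z0 x y = {z. integer_point z \<and>
      (\<exists>t. 0 \<le> t \<and> t \<le> 1 \<and> x + t *\<^sub>R (y - x) \<in> closed_segment z (z + of_int d *\<^sub>R p))}" for x y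
  have sub: "Z0 x y \<subseteq> Z0 y x" for x y
  proof
    fix z assume "z \<in> Z0 x y"
    then obtain t where t: "integer_point z" "0 \<le> t" "t \<le> 1"
      "x + t *\<^sub>R (y - x) \<in> closed_segment z (z + of_int d *\<^sub>R p)" by (auto simp: Z0_def)
    moreover have "x + t *\<^sub>R (y - x) = y + (1 - t) *\<^sub>R (x - y)" by (simp add: algebra_simps)
    ultimately show "z \<in> Z0 y x" unfolding Z0_def by (auto intro!: exI[of _ "1 - t"])
  qed
  have off': "\<not> integer_point (y + t *\<^sub>R (x - y))" if "0 \<le> t" "t \<le> 1" for t
    using off[of "1 - t"] that by (simp add: algebra_simps)
  have "finite (Z0 x y) \<and> even (int (card (Z0 x y)) - d * (\<lfloor>det2 p x\<rfloor> - \<lfloor>det2 p y\<rfloor>))"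
  proof (cases "det2 p x < det2 p y")
    case True
    have *: "finite (Z0 x y) \<and> int (card (Z0 x y)) = d * (\<lfloor>det2 p y\<rfloor> - \<lfloor>det2 p x\<rfloor>)"
      unfolding Z0_def by (rule lattice_translates_crossing[OF d p True nint(1) off])
    then show ?thesis by auto
  next
    case False
    then have "det2 p y < det2 p x" using ne by simp
    then have *: "finite (Z0 y x) \<and> int (card (Z0 y x)) = d * (\<lfloor>det2 p x\<rfloor> - \<lfloor>det2 p y\<rfloor>)"
      unfolding Z0_def by (rule lattice_translates_crossing[OF d p _ nint(2) off'])
    then show ?thesis using sub[of x y] sub[of y x] by (simp add: subset_antisym)
  qed
  moreover have "bij_betw (\<lambda>z. z + v) Z (Z0 x y)"
  proof (rule bij_betwI[where g = "\<lambda>z. z - v"])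
  qed (use v in \<open>auto simp: Z_def Z0_def\<close>)
  ultimately show ?thesis using bij_betw_finite bij_betw_same_card by metis
qed

section \<open>Parity of the number of lattice translates\<close>

lemma AE_det2_neq:
  assumes "u \<noteq> 0"
  shows "AE w in lebesgue. det2 u w \<noteq> c"
proof -
  have "vector [- (u $ 2), u $ 1] \<noteq> (0::real^2)"
    using assms by (auto simp: vec_eq_iff forall_2)
  then have "negligible {w. vector [- (u $ 2), u $ 1] \<bullet> (w::real^2) = c}"
    by (intro negligible_hyperplane) auto
  then have "negligible {w. det2 u w = c}" by (simp add: det2_eq_inner)
  then have "{w. det2 u w = c} \<in> null_sets lebesgue" by (simp add: negligible_iff_null_sets)
  from AE_not_in[OF this] show ?thesis by simp
qed

lemma AE_det2_not_Ints:
  assumes "u \<noteq> 0"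
  shows "AE w in lebesgue. det2 u w + c \<notin> \<int>"
proof -
  have "AE w in lebesgue. \<forall>n\<in>(UNIV :: int set). det2 u w \<noteq> of_int n - c"
    by (subst AE_ball_countable) (auto intro: AE_det2_neq[OF assms])
  then show ?thesis by (auto elim!: eventually_mono Ints_cases simp: algebra_simps)
qed

lemma ex_of_AE_lebesgue:
  assumes "AE w in lebesgue. R (w :: 'a::euclidean_space)"
  shows "\<exists>w. R w"
proof -
  have "ae_filter (lebesgue :: 'a measure) \<noteq> bot"
    by (simp add: ae_filter_eq_bot_iff emeasure_lborel_UNIV)
  then show ?thesis using assms eventually_happens' by blast
qed

section \<open>The parity function of the integer translates of an integer polygon\<close>

locale lattice_polygon =
  fixes Q :: "(real^2) set" and ws :: "(real^2) list"
    and d :: "nat \<Rightarrow> int" and p q :: "nat \<Rightarrow> real^2"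
  assumes poly: "polygon_with_vertices Q ws"
    and vertices: "\<And>v. v \<in> set ws \<Longrightarrow> integer_point v"
    and not_parallel: "no_parallel_edges ws"
    and d_pos: "\<And>i. i < length ws \<Longrightarrow> 0 < d i"
    and p_int: "\<And>i. i < length ws \<Longrightarrow> integer_point (p i)"
    and q_int: "\<And>i. i < length ws \<Longrightarrow> integer_point (q i)"
    and pq: "\<And>i. i < length ws \<Longrightarrow> det2 (p i) (q i) = 1"
    and edge_eq: "\<And>i. i < length ws \<Longrightarrow> next_vertex ws i - ws ! i = of_int (d i) *\<^sub>R p i"
begin

text \<open>The excluded lines contain all integer translates of all edges.\<close>

definition generic :: "real^2 \<Rightarrow> bool" where
  "generic x \<longleftrightarrow> (\<forall>i<length ws. det2 (p i) x \<notin> \<int>)"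

text \<open>Its cardinality modulo 2 is the function \<open>F\<close> of the introduction.\<close>

definition hits :: "real^2 \<Rightarrow> (real^2) set" where
  "hits x = {z. integer_point z \<and> x - z \<in> Q}"

text \<open>The nonconstant part of the floor formula for \<open>F\<close>.\<close>

definition height :: "real^2 \<Rightarrow> int" where
  "height x = (\<Sum>i<length ws. d i * \<lfloor>det2 (p i) x\<rfloor>)"

lemma length_ws: "3 \<le> length ws"
  using polygon_edges(1)[OF poly] .

lemma p_nonzero: "i < length ws \<Longrightarrow> p i \<noteq> 0"
  using pq by fastforce

lemma vertex_int: "i < length ws \<Longrightarrow> integer_point (ws ! i)"
  by (simp add: vertices)

lemma next_vertex_eq: "i < length ws \<Longrightarrow> next_vertex ws i = ws ! i + of_int (d i) *\<^sub>R p i"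
  using edge_eq by (metis add.commute diff_add_cancel)

lemma finite_hits: "finite (hits x)"
proof -
  have "bounded Q" using polygon_Jordan(9)[OF poly] compact_imp_bounded by blast
  then have "bounded ((+) x ` uminus ` Q)" by (intro bounded_translation) simp
  then have "bounded ((\<lambda>y. x - y) ` Q)" by (simp add: image_image)
  then have "finite {z \<in> (\<lambda>y. x - y) ` Q. integer_point z}" by (rule finite_integer_points)
  moreover have "hits x \<subseteq> {z \<in> (\<lambda>y. x - y) ` Q. integer_point z}"
    by (auto simp: hits_def intro!: image_eqI[of _ _ "x - _"])
  ultimately show ?thesis by (rule finite_subset[rotated])
qed

lemma generic_not_on_edge:
  assumes "generic x" "integer_point z"
  shows "x - z \<notin> (\<Union>i<length ws. edge ws i)"
proof
  assume "x - z \<in> (\<Union>i<length ws. edge ws i)"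
  then obtain i where i: "i < length ws" "x - z \<in> edge ws i" by auto
  have "of_int (d i) * det2 (p i) (x - z - ws ! i) = 0"
    using edge_det2[OF i(2)] unfolding edge_eq[OF i(1)] det2_simps(5) .
  then have "det2 (p i) (x - z - ws ! i) = 0"
    using d_pos[OF i(1)] by (metis less_irrefl mult_eq_0_iff of_int_eq_0_iff)
  then have "det2 (p i) x = det2 (p i) (z + ws ! i)" by simp
  moreover have "det2 (p i) (z + ws ! i) \<in> \<int>"
    by (intro det2_integer p_int i integer_point_simps assms vertex_int)
  ultimately show False using assms i by (auto simp: generic_def)
qed

lemma generic_not_integer: "generic x \<Longrightarrow> \<not> integer_point x"
  using length_ws det2_integer p_int[of 0] by (force simp: generic_def)

text \<open>Double counting of the pairs of an integer point \<open>z\<close> and an edge of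
  \<open>Q + z\<close> met by the segment. For fixed \<open>z\<close>,
  \<open>crossing_parity\<close> detects whether \<open>z\<close> belongs to exactly one of
  \<open>hits x\<close> and \<open>hits y\<close>; for a fixed edge,
  \<open>lattice_translates_crossing_parity\<close> gives the difference of floors.\<close>

lemma hits_parity_step:
  assumes x: "generic x" and y: "generic y"
    and off: "\<And>t. 0 \<le> t \<Longrightarrow> t \<le> 1 \<Longrightarrow> \<not> integer_point (x + t *\<^sub>R (y - x))"
    and trans: "\<And>i. i < length ws \<Longrightarrow> det2 (p i) (y - x) \<noteq> 0"
  shows "even (int (card (hits x)) - int (card (hits y)) - (height x - height y))"
proof -
  define Z where "Z i = {z. integer_point z \<and>
      (\<exists>t. 0 \<le> t \<and> t \<le> 1 \<and> x + t *\<^sub>R (y - x) - z \<in> edge ws i)}" for i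
  have Z_eq: "Z i = {z. integer_point z \<and> (\<exists>t. 0 \<le> t \<and> t \<le> 1 \<and>
      x + t *\<^sub>R (y - x) \<in> closed_segment (z + ws ! i) (z + ws ! i + of_int (d i) *\<^sub>R p i))}"
    if "i < length ws" for i
  proof -
    have "w - z \<in> edge ws i \<longleftrightarrow>
        w \<in> closed_segment (z + ws ! i) (z + ws ! i + of_int (d i) *\<^sub>R p i)" for w z
      using closed_segment_translation_eq[of z "w - z" "ws ! i" "next_vertex ws i"]
      by (simp add: edge_def next_vertex_eq[OF that] add.assoc)
    then show ?thesis unfolding Z_def by simp
  qed
  have "finite (Z i) \<and> even (int (card (Z i)) - d i * (\<lfloor>det2 (p i) x\<rfloor> - \<lfloor>det2 (p i) y\<rfloor>))"
    if i: "i < length ws" for i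
    unfolding Z_eq[OF i]
    by (rule lattice_translates_crossing_parity[OF d_pos[OF i] p_int[OF i] q_int[OF i] pq[OF i]
          vertex_int[OF i] trans[OF i] _ _ off])
      (use x y i in \<open>auto simp: generic_def\<close>)
  then have Z: "finite (Z i)" "even (int (card (Z i)) - d i * (\<lfloor>det2 (p i) x\<rfloor> - \<lfloor>det2 (p i) y\<rfloor>))"
    if "i < length ws" for i
    using that by blast+
  \<comment> \<open>A finite set outside of which no \<open>z\<close> contributes to any of the
    three counts.\<close>
  define B where "B = hits x \<union> hits y \<union> (\<Union>i<length ws. Z i)"
  have B: "finite B" "\<And>z. z \<in> B \<Longrightarrow> integer_point z"
  proof -
    show "finite B" using Z(1) finite_hits by (simp add: B_def)
    show "integer_point z" if "z \<in> B" for z using that by (auto simp: B_def hits_def Z_def)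
  qed
  have crossing: "even (of_bool (z \<in> hits x) + of_bool (z \<in> hits y) - int (card {i. i < length ws \<and> z \<in> Z i}))"
    if z: "z \<in> B" for z
  proof -
    have zi: "integer_point z" using B z by blast
    have "(x - z + 0 *\<^sub>R (y - x) \<in> Q \<longleftrightarrow> x - z + 1 *\<^sub>R (y - x) \<in> Q) \<longleftrightarrow>
      even (card {i. i < length ws \<and> (\<exists>t. 0 \<le> t \<and> t \<le> 1 \<and> x - z + t *\<^sub>R (y - x) \<in> edge ws i)})"
    proof (rule crossing_parity[OF poly])
      show "det2 (next_vertex ws i - ws ! i) (y - x) \<noteq> 0" if "i < length ws" for i
        using trans[OF that] d_pos[OF that] unfolding edge_eq[OF that] det2_simps(5) by simp
      show "x - z + 0 *\<^sub>R (y - x) \<notin> (\<Union>i<length ws. edge ws i)"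
        "x - z + 1 *\<^sub>R (y - x) \<notin> (\<Union>i<length ws. edge ws i)"
        using generic_not_on_edge[OF x zi] generic_not_on_edge[OF y zi] by (simp_all add: algebra_simps)
      show "x - z + t *\<^sub>R (y - x) \<notin> set ws" if t: "0 \<le> t" "t \<le> 1" for t
      proof
        assume "x - z + t *\<^sub>R (y - x) \<in> set ws"
        then have "integer_point (x - z + t *\<^sub>R (y - x) + z)"
          using integer_point_simps(3)[OF vertices zi] by blast
        then show False using off[OF t] by (simp add: algebra_simps)
      qed
    qed simp
    moreover have "{i. i < length ws \<and> z \<in> Z i} =
        {i. i < length ws \<and> (\<exists>t. 0 \<le> t \<and> t \<le> 1 \<and> x - z + t *\<^sub>R (y - x) \<in> edge ws i)}"
      using zi by (auto simp: Z_def algebra_simps)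
    ultimately show ?thesis using zi by (auto simp: hits_def algebra_simps)
  qed
  have "even (\<Sum>z\<in>B. of_bool (z \<in> hits x) + of_bool (z \<in> hits y) - int (card {i. i < length ws \<and> z \<in> Z i}))"
    by (rule dvd_sum) (use crossing in blast)
  moreover have "(\<Sum>z\<in>B. of_bool (z \<in> hits x)) = int (card (hits x))"
    "(\<Sum>z\<in>B. of_bool (z \<in> hits y)) = int (card (hits y))"
    using B(1) by (auto simp: B_def Int_absorb1 sup_assoc simp flip: sum.inter_filter
        intro!: arg_cong[where f=card] simp add: of_bool_def sum.If_cases)
  moreover have "(\<Sum>z\<in>B. int (card {i. i < length ws \<and> z \<in> Z i})) = (\<Sum>i<length ws. int (card (Z i)))"
  proof -
    have "(\<Sum>z\<in>B. card {i\<in>{..<length ws}. z \<in> Z i}) = (\<Sum>i<length ws. card {z\<in>B. z \<in> Z i})"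
      by (rule sum_multicount_gen[symmetric]) (use B in auto)
    moreover have "{z \<in> B. z \<in> Z i} = Z i" if "i < length ws" for i using that by (auto simp: B_def)
    ultimately show ?thesis by (simp flip: of_nat_sum)
  qed
  ultimately have *: "even (int (card (hits x)) + int (card (hits y)) - (\<Sum>i<length ws. int (card (Z i))))"
    by (simp add: sum_subtractf sum.distrib)
  have "even (\<Sum>i<length ws. int (card (Z i)) - d i * (\<lfloor>det2 (p i) x\<rfloor> - \<lfloor>det2 (p i) y\<rfloor>))"
    by (rule dvd_sum) (use Z(2) in blast)
  then have "even ((\<Sum>i<length ws. int (card (Z i))) - (height x - height y))"
    by (simp add: height_def sum_subtractf right_diff_distrib)
  then show ?thesis using * by presburger
qed

text \<open>Along the affine map \<open>det2 (p i)\<close> becomes, up to an additive constant, a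
  nonzero multiple of \<open>det2 (matrix_inv A *v p i)\<close>, so the exceptional points lie on
  countably many lines. The affine form is what the pull-back from \<open>Q\<close> to
  \<open>P\<close> requires.\<close>

lemma AE_generic:
  assumes "det A \<noteq> 0"
  shows "AE x in lebesgue. generic (A *v x + c)"
proof -
  have "det2 (p i) (A *v x + c) = det2 (matrix_inv A *v p i) x * det A + det2 (p i) c" for x i
  proof -
    have "A *v (matrix_inv A *v p i) = p i"
      using matrix_inv_mult[of A] assms by (simp add: invertible_det_nz matrix_vector_mul_assoc)
    then show ?thesis using det2_matrix[of A "matrix_inv A *v p i" x] by simp
  qed
  moreover have "AE x in lebesgue. det2 (matrix_inv A *v p i) x * det A + det2 (p i) c \<notin> \<int>"
    if "i < length ws" for i
  proof -
    have "A *v (matrix_inv A *v p i) = p i"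
      using matrix_inv_mult[of A] assms by (simp add: invertible_det_nz matrix_vector_mul_assoc)
    then have "det A *\<^sub>R (matrix_inv A *v p i) \<noteq> 0"
      using assms p_nonzero[OF that] by auto
    from AE_det2_not_Ints[OF this, of "det2 (p i) c"] show ?thesis by (simp add: mult.commute)
  qed
  ultimately have "AE x in lebesgue. \<forall>i\<in>{..<length ws}. det2 (p i) (A *v x + c) \<notin> \<int>"
    by (subst AE_ball_countable) auto
  then show ?thesis by (auto simp: generic_def elim!: eventually_mono)
qed

text \<open>Almost every \<open>w\<close> can be joined to both \<open>x\<close> and \<open>y\<close> by segments that avoid all integer points.\<close>

lemma hits_parity:
  assumes x: "generic x" and y: "generic y"
  shows "even (int (card (hits x)) - int (card (hits y)) - (height x - height y))"
proof -
  have good: "AE w in lebesgue. (\<forall>i<length ws. det2 (p i) (w - x) \<noteq> 0) \<and>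
      (\<forall>t. 0 \<le> t \<longrightarrow> t \<le> 1 \<longrightarrow> \<not> integer_point (x + t *\<^sub>R (w - x)))" if x: "generic x" for x
  proof -
    have "AE w in lebesgue. \<forall>i\<in>{..<length ws}. det2 (p i) w \<noteq> det2 (p i) x"
      by (subst AE_ball_countable) (auto intro!: AE_det2_neq p_nonzero simp del: det2_simps)
    \<comment> \<open>An integer point \<open>z\<close> on the segment from \<open>x\<close> to
      \<open>w\<close> would put \<open>w\<close> on the line through \<open>x\<close> and
      \<open>z\<close>. There are countably many such lines, and none degenerates because a generic
      \<open>x\<close> is not an integer point.\<close>
    moreover have "AE w in lebesgue. \<forall>z\<in>{z. integer_point z}. det2 (z - x) w \<noteq> det2 (z - x) x"
      using generic_not_integer[OF x]
      by (subst AE_ball_countable[OF countable_integer_points]) (auto intro!: AE_det2_neq simp del: det2_simps)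
    ultimately show ?thesis
    proof eventually_elim
      case (elim w)
      have "\<not> integer_point (x + t *\<^sub>R (w - x))" for t
      proof
        assume "integer_point (x + t *\<^sub>R (w - x))"
        then have "det2 (t *\<^sub>R (w - x)) w \<noteq> det2 (t *\<^sub>R (w - x)) x"
          using elim(2) by (auto simp del: det2_simps)
        then show False using det2_commute[of w x] by (simp add: algebra_simps)
      qed
      then show ?case using elim(1) by simp
    qed
  qed
  have "AE w in lebesgue. generic w"
    using AE_generic[of "mat 1" 0] by simp
  with good[OF x] good[OF y] have ae: "AE w in lebesgue. generic w \<and> (\<forall>i<length ws. det2 (p i) (w - x) \<noteq> 0) \<and>
      (\<forall>t. 0 \<le> t \<longrightarrow> t \<le> 1 \<longrightarrow> \<not> integer_point (x + t *\<^sub>R (w - x))) \<and>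
      (\<forall>i<length ws. det2 (p i) (w - y) \<noteq> 0) \<and>
      (\<forall>t. 0 \<le> t \<longrightarrow> t \<le> 1 \<longrightarrow> \<not> integer_point (y + t *\<^sub>R (w - y)))"
    by eventually_elim blast
  from ex_of_AE_lebesgue[OF ae] obtain w where w: "generic w" "\<forall>i<length ws. det2 (p i) (w - x) \<noteq> 0"
      "\<forall>t. 0 \<le> t \<longrightarrow> t \<le> 1 \<longrightarrow> \<not> integer_point (x + t *\<^sub>R (w - x))"
      "\<forall>i<length ws. det2 (p i) (w - y) \<noteq> 0"
      "\<forall>t. 0 \<le> t \<longrightarrow> t \<le> 1 \<longrightarrow> \<not> integer_point (y + t *\<^sub>R (w - y))"
    by blast
  have "even (int (card (hits x)) - int (card (hits w)) - (height x - height w))"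
    using w by (intro hits_parity_step[OF x w(1)]) blast+
  moreover have "even (int (card (hits y)) - int (card (hits w)) - (height y - height w))"
    using w by (intro hits_parity_step[OF y w(1)]) blast+
  ultimately show ?thesis by presburger
qed

end

section \<open>Shifts that make the parity constant\<close>

lemma sum_Pow_insert:
  assumes "finite A" "k \<notin> A"
  shows "(\<Sum>J\<in>Pow (insert k A). g J) = (\<Sum>J\<in>Pow A. g J) + (\<Sum>J\<in>Pow A. g (insert k J))"
proof -
  have "inj_on (insert k) (Pow A)" using assms(2) by (auto intro!: inj_onI)
  moreover have "Pow A \<inter> insert k ` Pow A = {}" using assms(2) by auto
  ultimately show ?thesis
    using assms(1) by (simp add: Pow_insert sum.union_disjoint sum.reindex)
qed

text \<open>Pairing \<open>J\<close> with \<open>insert k J\<close> makes every value occur twice.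
  This is how a factor \<open>1 + T\<^sub>h\<close> kills a function that is invariant under
  \<open>h\<close>.\<close>

lemma even_sum_Pow_invariant:
  fixes g :: "'a set \<Rightarrow> int"
  assumes "finite A" "k \<in> A" "\<And>J. J \<subseteq> A - {k} \<Longrightarrow> g (insert k J) = g J"
  shows "even (\<Sum>J\<in>Pow A. g J)"
proof -
  have "(\<Sum>J\<in>Pow (insert k (A - {k})). g J) = 2 * (\<Sum>J\<in>Pow (A - {k}). g J)"
    by (subst sum_Pow_insert) (use assms in auto)
  then show ?thesis using assms(2) by (simp add: insert_absorb)
qed

text \<open>Over the two-element field, with \<open>T\<close> a translation,
  \<open>(1 + T) (1 + T) (1 + T\<^sup>2) (1 + T\<^sup>4) \<dots>\<close> telescopes because \<open>(1 + S)\<^sup>2 = 1 + S\<^sup>2\<close>.\<close>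

lemma even_sum_Pow_dyadic:
  fixes f :: "real \<Rightarrow> int" and c :: real
  defines "a \<equiv> \<lambda>j. if j = 0 then c else 2 ^ (j - 1) * c"
  shows "even ((\<Sum>J\<in>Pow {..<Suc m}. f (y - sum a J)) - f y - f (y - 2 ^ m * c))"
proof (induction m arbitrary: y)
  case 0
  have "Pow {..<Suc 0} = {{}, {0}}" by (auto simp: lessThan_Suc)
  then show ?case by (simp add: a_def)
next
  case (Suc m)
  have "(\<Sum>J\<in>Pow {..<Suc (Suc m)}. f (y - sum a J)) = (\<Sum>J\<in>Pow {..<Suc m}. f (y - sum a J)) +
      (\<Sum>J\<in>Pow {..<Suc m}. f (y - sum a (insert (Suc m) J)))"
    unfolding lessThan_Suc[of "Suc m"] by (rule sum_Pow_insert) auto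
  also have "(\<Sum>J\<in>Pow {..<Suc m}. f (y - sum a (insert (Suc m) J))) =
      (\<Sum>J\<in>Pow {..<Suc m}. f ((y - 2 ^ m * c) - sum a J))"
  proof (rule sum.cong)
    fix J assume J: "J \<in> Pow {..<Suc m}"
    then have "finite J" "Suc m \<notin> J" by (auto intro: finite_subset)
    then have "sum a (insert (Suc m) J) = 2 ^ m * c + sum a J" by (simp add: a_def)
    then show "f (y - sum a (insert (Suc m) J)) = f ((y - 2 ^ m * c) - sum a J)"
      by (simp add: algebra_simps)
  qed simp
  finally have eq: "(\<Sum>J\<in>Pow {..<Suc (Suc m)}. f (y - sum a J)) = (\<Sum>J\<in>Pow {..<Suc m}. f (y - sum a J)) +
      (\<Sum>J\<in>Pow {..<Suc m}. f ((y - 2 ^ m * c) - sum a J))" .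
  \<comment> \<open>The induction hypotheses at \<open>y\<close> and at \<open>y - 2 ^ m * c\<close>
    share the term \<open>f (y - 2 ^ m * c)\<close>, which cancels modulo 2.\<close>
  have "(y - 2 ^ m * c) - 2 ^ m * c = y - 2 ^ Suc m * c" by simp
  then show ?case
    using Suc.IH[of y] Suc.IH[of "y - 2 ^ m * c"] unfolding eq by (simp only:) presburger
qed

lemma det2_sum_right: "det2 u (sum h J) = (\<Sum>j\<in>J. det2 u (h j))"
  by (induction J rule: infinite_finite_induct) auto

context lattice_polygon
begin

text \<open>The subsets \<open>J\<close> index the terms in the expansion of a product of operators
  \<open>1 + T\<^sub>h\<close>, one for each edge but the \<open>l\<close>-th. The number of terms
  is even, so the unknown constant between \<open>hits\<close> and \<open>height\<close> drops
  out.\<close>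

lemma odd_shifts:
  assumes l: "l < length ws" "odd (d l)"
  shows "\<exists>h. \<forall>x. (\<forall>J\<in>Pow {..<length ws - 1}. generic (x - sum h J)) \<longrightarrow>
    odd (\<Sum>J\<in>Pow {..<length ws - 1}. card (hits (x - sum h J)))"
proof -
  define n where "n = length ws"
  define m where "m = n - 2"
  have n: "3 \<le> n" "n - 1 = Suc m" using length_ws by (auto simp: n_def m_def)
  \<comment> \<open>Enumerates the edges other than \<open>l\<close> cyclically, starting just after
    \<open>l\<close>.\<close>
  define \<pi> where "\<pi> j = (Suc l + j) mod n" for j
  \<comment> \<open>Modulo 2 the shifts \<open>c, c, 2 c, 4 c, \<dots>\<close> leave only the shifts
    by 0 and by \<open>2 ^ m * c\<close>; this choice makes the latter a unit shift.\<close>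
  define c :: real where "c = 1 / 2 ^ m"
  define a :: "nat \<Rightarrow> real" where "a = (\<lambda>j. if j = 0 then c else 2 ^ (j - 1) * c)"
  \<comment> \<open>Being parallel to \<open>p (\<pi> j)\<close>, this shift preserves the summand
    of edge \<open>\<pi> j\<close>; the factor makes it move \<open>det2 (p l)\<close> by exactly
    \<open>a j\<close>.\<close>
  define h where "h j = (a j / det2 (p l) (p (\<pi> j))) *\<^sub>R p (\<pi> j)" for j
  have \<pi>_less: "\<pi> j < n" for j using n by (simp add: \<pi>_def)
  have \<pi>_neq: "\<pi> j \<noteq> l" if "j < Suc m" for j
  proof
    assume "\<pi> j = l"
    moreover have "l < n" "j < n - 1" using l that n by (auto simp: n_def)
    ultimately show False by (cases "Suc l + j < n") (auto simp: \<pi>_def le_mod_geq)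
  qed
  have \<pi>_surj: "\<exists>j<Suc m. \<pi> j = i" if "i < n" "i \<noteq> l" for i
  proof (cases "l < i")
    case True
    then show ?thesis using that n by (intro exI[of _ "i - Suc l"]) (auto simp: \<pi>_def m_def)
  next
    case False
    then have "Suc l + (n - Suc l + i) = n + i" "n - Suc l + i < Suc m"
      using that l n by (auto simp: n_def m_def)
    then show ?thesis using that by (intro exI[of _ "n - Suc l + i"]) (auto simp: \<pi>_def)
  qed
  have transversal: "det2 (p l) (p (\<pi> j)) \<noteq> 0" if "j < Suc m" for j
    using edges_not_parallel[OF not_parallel l(1), of "\<pi> j"] \<pi>_less[of j] \<pi>_neq[OF that] l
    by (auto simp: n_def edge_eq simp del: det2_simps(3,4))
  have det_h: "det2 (p l) (h j) = a j" if "j < Suc m" for j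
    using transversal[OF that] by (simp add: h_def)
  have inner_odd: "odd (\<Sum>J\<in>Pow {..<Suc m}. \<lfloor>det2 (p l) (x - sum h J)\<rfloor>)" for x
  proof -
    have "(\<Sum>J\<in>Pow {..<Suc m}. \<lfloor>det2 (p l) (x - sum h J)\<rfloor>) =
        (\<Sum>J\<in>Pow {..<Suc m}. \<lfloor>det2 (p l) x - sum a J\<rfloor>)"
    proof (rule sum.cong)
      fix J assume "J \<in> Pow {..<Suc m}"
      then have "det2 (p l) (sum h J) = sum a J"
        unfolding det2_sum_right by (intro sum.cong) (auto simp: det_h)
      then show "\<lfloor>det2 (p l) (x - sum h J)\<rfloor> = \<lfloor>det2 (p l) x - sum a J\<rfloor>" by simp
    qed simp
    \<comment> \<open>A unit shift changes the floor by one, so the two terms that remain have an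
      odd sum.\<close>
    moreover have "\<lfloor>det2 (p l) x - 2 ^ m * c\<rfloor> = \<lfloor>det2 (p l) x\<rfloor> - 1" by (simp add: c_def)
    ultimately show ?thesis
      using even_sum_Pow_dyadic[where m = m and f = floor and y = "det2 (p l) x" and c = c, folded a_def] by presburger
  qed
  have inner_even: "even (\<Sum>J\<in>Pow {..<Suc m}. \<lfloor>det2 (p i) (x - sum h J)\<rfloor>)" if i: "i < n" "i \<noteq> l" for i x
  proof -
    obtain k where k: "k < Suc m" "\<pi> k = i" using \<pi>_surj[OF i] by blast
    show ?thesis
    proof (rule even_sum_Pow_invariant[of _ k])
      fix J assume "J \<subseteq> {..<Suc m} - {k}"
      then have "finite J" "k \<notin> J" by (auto intro: finite_subset)
      then have "sum h (insert k J) = h k + sum h J" by simp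
      then show "\<lfloor>det2 (p i) (x - sum h (insert k J))\<rfloor> = \<lfloor>det2 (p i) (x - sum h J)\<rfloor>"
        using k(2) by (simp add: h_def)
    qed (use k in auto)
  qed
  have "odd (\<Sum>J\<in>Pow {..<n - 1}. card (hits (x - sum h J)))"
    if gen: "\<forall>J\<in>Pow {..<n - 1}. generic (x - sum h J)" for x
  proof -
    let ?P = "Pow {..<Suc m}"
    have height_sum: "(\<Sum>J\<in>?P. height (x - sum h J)) =
        (\<Sum>i<n. d i * (\<Sum>J\<in>?P. \<lfloor>det2 (p i) (x - sum h J)\<rfloor>))"
      unfolding height_def n_def[symmetric] sum_distrib_left by (rule sum.swap)
    have "even (\<Sum>i\<in>{..<n} - {l}. d i * (\<Sum>J\<in>?P. \<lfloor>det2 (p i) (x - sum h J)\<rfloor>))"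
      by (rule dvd_sum) (use inner_even in auto)
    then have "odd (\<Sum>J\<in>?P. height (x - sum h J))"
      unfolding height_sum using l inner_odd[of x] by (subst sum.remove[of _ l]) (auto simp: n_def)
    \<comment> \<open>Every term is compared with that of the empty set; over an even number of
      terms the reference values cancel.\<close>
    moreover have "even (\<Sum>J\<in>?P. int (card (hits (x - sum h J))) - int (card (hits (x - sum h {})))
        - (height (x - sum h J) - height (x - sum h {})))"
    proof (intro dvd_sum hits_parity)
      show "generic (x - sum h {})" using gen by (rule bspec) auto
    qed (use gen n in auto)
    moreover have "even (card ?P)" by (simp add: card_Pow)
    ultimately have "odd (\<Sum>J\<in>?P. int (card (hits (x - sum h J))))"
      by (simp add: sum_subtractf)
    then show ?thesis using n by (simp flip: of_nat_sum)
  qed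
  then show ?thesis unfolding n_def by blast
qed

end

section \<open>Packing and covering by lattice translates\<close>

lemma in_translation_iff: "(x :: 'a::ab_group_add) \<in> (+) z ` S \<longleftrightarrow> x - z \<in> S"
  by (auto intro!: image_eqI[of _ _ "x - z"])

lemma AE_shift:
  assumes "AE x in lebesgue. R (x :: 'a::euclidean_space)"
  shows "AE x in lebesgue. R (x - c)"
proof -
  obtain N where N: "negligible N" "{x. \<not> R x} \<subseteq> N"
    using assms by (auto simp: eventually_ae_filter_negligible)
  have "negligible ((+) c ` N)" using N(1) by (rule negligible_translation)
  moreover have "{x. \<not> R (x - c)} \<subseteq> (+) c ` N"
    using N(2) by (auto intro!: image_eqI[of _ _ "_ - c"])
  ultimately show ?thesis by (auto simp: eventually_ae_filter_negligible)
qed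

locale planar_lattice =
  fixes A :: "real^2^2"
  assumes inv_A: "invertible A"
begin

definition lattice :: "(real^2) set" where
  "lattice = {z. integer_point (A *v z)}"

text \<open>A fundamental parallelogram of \<open>lattice\<close>, half-open so that its lattice
  translates are disjoint everywhere and not only up to null sets.\<close>

definition cell :: "(real^2) set" where
  "cell = {x. \<forall>j. 0 \<le> (A *v x) $ j \<and> (A *v x) $ j < 1}"

lemma A_inverse: "A *v (matrix_inv A *v x) = x" "matrix_inv A *v (A *v x) = x"
  using matrix_inv_mult[OF inv_A] by (simp_all add: matrix_vector_mul_assoc)

lemma det_A: "det A \<noteq> 0"
  using inv_A by (simp add: invertible_det_nz)

lemma lattice_diff: "z \<in> lattice \<Longrightarrow> z' \<in> lattice \<Longrightarrow> z - z' \<in> lattice"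
  by (simp add: lattice_def matrix_vector_mult_diff_distrib)

lemma cell_bounded: "bounded cell" and cell_measurable: "cell \<in> lmeasurable"
  and area_cell: "area cell = 1 / \<bar>det A\<bar>"
proof -
  define U :: "(real^2) set" where "U = {x. \<forall>j. 0 \<le> x $ j \<and> x $ j < 1}"
  have sub: "box 0 1 \<subseteq> U" "U \<subseteq> cbox 0 (1::real^2)"
    by (auto simp: U_def mem_box_cart less_imp_le)
  \<comment> \<open>The half-open unit square differs from the closed one only on its boundary, a
    null set.\<close>
  have neg: "negligible ((cbox 0 1 - U) \<union> (U - cbox 0 1))"
    by (rule negligible_subset[OF negligible_frontier_interval[of 0 1]]) (use sub in auto)
  have U: "U \<in> lmeasurable" by (rule lmeasurable_negligible_symdiff[OF _ neg]) simp
  have "area U = area (cbox 0 (1::real^2))" by (rule measure_negligible_symdiff[OF _ neg]) simp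
  then have aU: "area U = 1"
  proof -
    have "(0::real^2) \<in> cbox 0 1" by (simp add: mem_box_cart)
    then have "cbox 0 (1::real^2) \<noteq> {}" by blast
    then have "measure lborel (cbox 0 (1::real^2)) = 1" by (simp add: content_cbox_cart)
    then show ?thesis using \<open>area U = area (cbox 0 1)\<close> by simp
  qed
  have cell: "cell = (*v) (matrix_inv A) ` U"
  proof (intro subset_antisym subsetI)
    fix x assume "x \<in> cell"
    then have "A *v x \<in> U" by (simp add: cell_def U_def)
    then show "x \<in> (*v) (matrix_inv A) ` U" by (metis A_inverse(2) image_eqI)
  qed (auto simp: cell_def U_def A_inverse)
  have "bounded U" using sub(2) bounded_cbox bounded_subset by blast
  then show "bounded cell" unfolding cell using bounded_affine_image[of U "matrix_inv A" 0] by simp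
  show "cell \<in> lmeasurable" unfolding cell by (rule measurable_linear_image) (auto simp: U)
  have "det A * det (matrix_inv A) = 1"
    using matrix_inv_mult(1)[OF inv_A] by (metis det_I det_mul)
  then have "det (matrix_inv A) = 1 / det A" using det_A by (simp add: field_simps)
  then show "area cell = 1 / \<bar>det A\<bar>"
    unfolding cell by (subst measure_linear_image) (auto simp: U aU abs_divide)
qed

lemma area_cell_pos: "0 < area cell"
  by (simp add: area_cell det_A)

text \<open>The coordinates of \<open>A *v (z - z')\<close> are integers, but also differences of
  two numbers that are at least 0 and less than 1; so they vanish.\<close>

lemma cell_translates_disjoint:
  assumes "x - z \<in> cell" "x - z' \<in> cell" "z \<in> lattice" "z' \<in> lattice"
  shows "z = z'"
proof -
  have "(A *v (z - z')) $ j = 0" for j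
  proof -
    have "integer_point (A *v (z - z'))" using lattice_diff[OF assms(3,4)] by (simp add: lattice_def)
    then obtain n where n: "(A *v (z - z')) $ j = of_int n"
      by (auto simp: integer_point_def elim!: Ints_cases)
    have "A *v (z - z') = A *v (x - z') - A *v (x - z)"
      by (simp flip: matrix_vector_mult_diff_distrib)
    moreover have "0 \<le> (A *v (x - z)) $ j" "(A *v (x - z)) $ j < 1"
      "0 \<le> (A *v (x - z')) $ j" "(A *v (x - z')) $ j < 1"
      using assms(1,2) by (auto simp: cell_def)
    ultimately have "\<bar>of_int n :: real\<bar> < 1" using n by simp
    then have "n = 0" by linarith
    then show ?thesis using n by simp
  qed
  then have "A *v (z - z') = 0" by (simp add: vec_eq_iff)
  then show ?thesis using A_inverse(2)[of "z - z'"] by simp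
qed

section \<open>Counting lattice points by comparing areas\<close>

lemma packing:
  assumes L: "finite L" "L \<subseteq> lattice" and E: "E \<in> lmeasurable"
    and sub: "\<And>z x. z \<in> L \<Longrightarrow> x \<in> cell \<Longrightarrow> z + x \<in> E"
  shows "card L * area cell \<le> area E"
proof -
  have m: "(+) z ` cell \<in> lmeasurable" for z by (simp add: measurable_translation cell_measurable)
  have "area (\<Union>z\<in>L. (+) z ` cell) = (\<Sum>z\<in>L. area ((+) z ` cell))"
  proof (rule measure_UNION'[OF L(1) m])
    show "pairwise (\<lambda>z z'. disjnt ((+) z ` cell) ((+) z' ` cell)) L"
    proof (rule pairwiseI, rule ccontr)
      fix z z' assume z: "z \<in> L" "z' \<in> L" "z \<noteq> z'" and "\<not> disjnt ((+) z ` cell) ((+) z' ` cell)"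
      then obtain x where "x \<in> (+) z ` cell" "x \<in> (+) z' ` cell" by (auto simp: disjnt_def)
      then have "x - z \<in> cell" "x - z' \<in> cell" by (simp_all only: in_translation_iff)
      then show False using cell_translates_disjoint z L(2) by blast
    qed
  qed
  also have "\<dots> = card L * area cell" by (simp add: measure_translation)
  finally have "card L * area cell = area (\<Union>z\<in>L. (+) z ` cell)" by simp
  also have "\<dots> \<le> area E"
  proof (rule measure_mono_fmeasurable[OF _ _ E])
    show "(\<Union>z\<in>L. (+) z ` cell) \<subseteq> E" using sub by auto
    show "(\<Union>z\<in>L. (+) z ` cell) \<in> sets lebesgue" using L(1) m by (auto intro!: sets.finite_UN fmeasurableD)
  qed
  finally show ?thesis .
qed

text \<open>\<open>packing\<close> bounds the sizes of all finite subsets at once, which forces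
  finiteness.\<close>

lemma packing_finite:
  assumes S: "S \<subseteq> lattice" and E: "E \<in> lmeasurable"
    and sub: "\<And>z x. z \<in> S \<Longrightarrow> x \<in> cell \<Longrightarrow> z + x \<in> E"
  shows "finite S" "card S * area cell \<le> area E"
proof -
  have "card G \<le> nat \<lfloor>area E / area cell\<rfloor>" if "G \<subseteq> S" "finite G" for G
  proof -
    have "card G * area cell \<le> area E" using that S by (intro packing[OF _ _ E]) (auto intro: sub)
    then have "real (card G) \<le> area E / area cell" using area_cell_pos by (simp add: pos_le_divide_eq)
    then show ?thesis by (simp add: le_nat_floor)
  qed
  then show "finite S" using finite_if_finite_subsets_card_bdd by blast
  then show "card S * area cell \<le> area E" by (rule packing[OF _ S E sub])
qed

text \<open>The cells attached to the counted points fit into a translate of the ball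
  \<open>E\<close>, whose area does not depend on \<open>c\<close>. The uniformity in
  \<open>c\<close> later gives the uniformly bounded degree.\<close>

lemma lattice_points_bounded:
  assumes "bounded B"
  shows "\<exists>N. \<forall>c. finite {z \<in> lattice. c + z \<in> B} \<and> card {z \<in> lattice. c + z \<in> B} \<le> N"
proof -
  obtain a where a: "\<And>x. x \<in> B \<Longrightarrow> norm x \<le> a" using assms by (auto simp: bounded_iff)
  obtain r where r: "\<And>x. x \<in> cell \<Longrightarrow> norm x \<le> r" using cell_bounded by (auto simp: bounded_iff)
  define E :: "(real^2) set" where "E = cball 0 (a + r)"
  have main: "finite {z \<in> lattice. c + z \<in> B}" "card {z \<in> lattice. c + z \<in> B} * area cell \<le> area E" for c
  proof -
    have E: "(+) (- c) ` E \<in> lmeasurable" unfolding E_def by (rule measurable_translation) simp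
    have sub: "z + x \<in> (+) (- c) ` E" if "z \<in> {z \<in> lattice. c + z \<in> B}" "x \<in> cell" for z x
    proof -
      have "norm ((c + z) + x) \<le> a + r"
        using that a r norm_triangle_mono by blast
      then have "c + z + x \<in> E" by (simp add: E_def)
      moreover have "z + x = - c + (c + z + x)" by simp
      ultimately show ?thesis by blast
    qed
    have sl: "{z \<in> lattice. c + z \<in> B} \<subseteq> lattice" by auto
    show "finite {z \<in> lattice. c + z \<in> B}" by (rule packing_finite(1)[OF sl E sub])
    show "card {z \<in> lattice. c + z \<in> B} * area cell \<le> area E"
      using packing_finite(2)[OF sl E sub] unfolding measure_translation .
  qed
  have "real (card {z \<in> lattice. c + z \<in> B}) \<le> area E / area cell" for c
    using main(2)[of c] area_cell_pos by (simp add: pos_le_divide_eq)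
  then have "card {z \<in> lattice. c + z \<in> B} \<le> nat \<lfloor>area E / area cell\<rfloor>" for c
    by (simp add: le_nat_floor)
  then show ?thesis using main(1) by blast
qed

lemma finite_lattice_points: "bounded B \<Longrightarrow> finite {z \<in> lattice. c + z \<in> B}"
  using lattice_points_bounded by blast

text \<open>The cells attached to the counted points lie in the square enlarged by a fixed margin
  \<open>R\<close> on every side. The leading term \<open>n\<^sup>2\<close> is the one that survives
  in the density.\<close>

lemma lattice_points_near_square:
  assumes "bounded B"
  shows "\<exists>R\<ge>0. \<forall>n. finite {z \<in> lattice. \<exists>b\<in>B. z + b \<in> centered_square n} \<and>
    card {z \<in> lattice. \<exists>b\<in>B. z + b \<in> centered_square n} * area cell \<le> (real n + 2 * R)\<^sup>2"
proof -
  obtain a where a: "0 \<le> a" "\<And>x. x \<in> B \<Longrightarrow> norm x \<le> a"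
    using assms by (meson bounded_pos less_imp_le)
  obtain r where r: "0 \<le> r" "\<And>x. x \<in> cell \<Longrightarrow> norm x \<le> r"
    using cell_bounded by (meson bounded_pos less_imp_le)
  define E :: "nat \<Rightarrow> (real^2) set" where
    "E n = cbox (\<chi> j. - (real n / 2 + (a + r))) (\<chi> j. real n / 2 + (a + r))" for n
  have E: "E n \<in> lmeasurable" for n by (simp add: E_def)
  have "E n \<noteq> {}" for n
  proof -
    have "0 \<in> E n" using a r by (simp add: E_def mem_box_cart)
    then show ?thesis by blast
  qed
  then have aE: "area (E n) = (real n + 2 * (a + r))\<^sup>2" for n
    using content_cbox_cart[of "\<chi> j. - (real n / 2 + (a + r))" "(\<chi> j. real n / 2 + (a + r)) :: real^2"]
    by (simp add: E_def power2_eq_square algebra_simps)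
  have sub: "z + x \<in> E n" if "z \<in> {z \<in> lattice. \<exists>b\<in>B. z + b \<in> centered_square n}" "x \<in> cell" for n z x
  proof -
    from that(1) obtain b where b: "b \<in> B" "z + b \<in> centered_square n" by auto
    have small: "\<bar>x $ j\<bar> \<le> r" "\<bar>b $ j\<bar> \<le> a" for j
      using component_le_norm_cart[of x j] component_le_norm_cart[of b j] r(2)[OF that(2)] a(2)[OF b(1)]
      by linarith+
    have "\<bar>(z + b) $ j\<bar> \<le> real n / 2" for j
    proof -
      have "- (real n / 2) \<le> (z + b) $ j" "(z + b) $ j \<le> real n / 2"
        using b(2) by (simp_all only: centered_square_def mem_box_cart vec_lambda_beta)
      then show ?thesis by linarith
    qed
    then have "\<bar>(z + x) $ j\<bar> \<le> real n / 2 + (a + r)" for j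
      using small[of j] by (smt (verit) vector_add_component)
    then show ?thesis by (simp only: E_def mem_box_cart vec_lambda_beta abs_le_iff minus_le_iff) simp
  qed
  have sl: "{z \<in> lattice. \<exists>b\<in>B. z + b \<in> centered_square n} \<subseteq> lattice" for n by auto
  show ?thesis
    using packing_finite[OF sl E sub] a r unfolding aE by (intro exI[of _ "a + r"]) auto
qed

text \<open>For each \<open>J\<close>, the parts of \<open>Y\<close> that the translations by
  \<open>s J + z\<close> carry into the cell are pairwise disjoint, so they cover an area of at most
  \<open>area Y\<close> there. For all \<open>J\<close> together they cover the cell up to a null
  set.\<close>

lemma covering_area:
  assumes I: "finite I" and Y: "Y \<in> lmeasurable" "bounded Y"
    and cover: "AE x in lebesgue. \<exists>J\<in>I. \<exists>z\<in>lattice. x - s J - z \<in> Y"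
  shows "area cell \<le> card I * area Y"
proof -
  obtain N where N: "negligible N" "{x. \<not> (\<exists>J\<in>I. \<exists>z\<in>lattice. x - s J - z \<in> Y)} \<subseteq> N"
    using cover by (auto simp: eventually_ae_filter_negligible)
  \<comment> \<open>The lattice points whose translate of \<open>Y\<close> meets the cell; there are
    finitely many because \<open>Y\<close> and the cell are bounded.\<close>
  define L where "L J = {z \<in> lattice. \<exists>x\<in>cell. x - s J - z \<in> Y}" for J
  have fin: "finite (L J)" for J
  proof -
    define B where "B = (\<lambda>(x, y). x - y) ` (cell \<times> Y)"
    have "bounded B" unfolding B_def using cell_bounded Y(2) by (rule bounded_minus)
    then have "finite {z \<in> lattice. s J + z \<in> B}" by (rule finite_lattice_points)
    moreover have "L J \<subseteq> {z \<in> lattice. s J + z \<in> B}"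
    proof
      fix z assume "z \<in> L J"
      then obtain x where x: "z \<in> lattice" "x \<in> cell" "x - s J - z \<in> Y" by (auto simp: L_def)
      have "s J + z = (\<lambda>(x, y). x - y) (x, x - s J - z)" by simp
      then have "s J + z \<in> B" unfolding B_def using x by blast
      then show "z \<in> {z \<in> lattice. s J + z \<in> B}" using x by simp
    qed
    ultimately show ?thesis by (rule finite_subset[rotated])
  qed
  define W where "W J z = Y \<inter> (+) (- (s J + z)) ` cell" for J z
  have Wm: "W J z \<in> lmeasurable" for J z
    unfolding W_def by (intro fmeasurable.Int Y measurable_translation cell_measurable)
  have tWm: "(+) (s J + z) ` W J z \<in> lmeasurable" for J z by (rule measurable_translation[OF Wm])
  have W: "(\<Sum>z\<in>L J. area (W J z)) \<le> area Y" for J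
  proof -
    have "area (\<Union>z\<in>L J. W J z) = (\<Sum>z\<in>L J. area (W J z))"
    proof (rule measure_UNION'[OF fin Wm])
      show "pairwise (\<lambda>z z'. disjnt (W J z) (W J z')) (L J)"
      proof (rule pairwiseI, rule ccontr)
        fix z z' assume z: "z \<in> L J" "z' \<in> L J" "z \<noteq> z'" and "\<not> disjnt (W J z) (W J z')"
        then obtain y where "y \<in> W J z" "y \<in> W J z'" by (auto simp: disjnt_def)
        then have "y - - (s J + z) \<in> cell" "y - - (s J + z') \<in> cell"
          by (simp_all only: W_def in_translation_iff Int_iff)
        \<comment> \<open>The auxiliary point \<open>y + s J + z + z'\<close> brings the two cell
          points into the form that \<open>cell_translates_disjoint\<close> expects.\<close>
        moreover have "(y + s J + z + z') - z' = y - - (s J + z)" "(y + s J + z + z') - z = y - - (s J + z')"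
          by simp_all
        ultimately have "z' = z"
          using cell_translates_disjoint[of "y + s J + z + z'" z' z] z by (simp only: L_def mem_Collect_eq)
        then show False using z(3) by simp
      qed
    qed
    moreover have "(\<Union>z\<in>L J. W J z) \<in> lmeasurable" by (rule fmeasurable.finite_UN[OF fin Wm])
    then have "area (\<Union>z\<in>L J. W J z) \<le> area Y"
      by (intro measure_mono_fmeasurable[OF _ _ Y(1)] fmeasurableD) (auto simp: W_def)
    ultimately show ?thesis by simp
  qed
  have "cell \<subseteq> N \<union> (\<Union>J\<in>I. \<Union>z\<in>L J. (+) (s J + z) ` W J z)"
  proof
    fix x assume x: "x \<in> cell"
    show "x \<in> N \<union> (\<Union>J\<in>I. \<Union>z\<in>L J. (+) (s J + z) ` W J z)"
    proof (cases "x \<in> N")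
      case False
      then obtain J z where J: "J \<in> I" "z \<in> lattice" "x - s J - z \<in> Y" using N(2) by blast
      then have "z \<in> L J" using x by (auto simp: L_def)
      moreover have "x - s J - z \<in> W J z" using J(3) x by (auto simp: W_def algebra_simps intro!: image_eqI[of _ _ x])
      then have "x \<in> (+) (s J + z) ` W J z" by (auto intro!: image_eqI[of _ _ "x - s J - z"])
      ultimately show ?thesis using J(1) by blast
    qed simp
  qed
  moreover have Nm: "N \<in> sets lebesgue" using N(1) by (simp add: negligible_imp_sets)
  have Um: "(\<Union>z\<in>L J. (+) (s J + z) ` W J z) \<in> lmeasurable" for J
    by (intro fmeasurable.finite_UN fin tWm)
  have UUm: "(\<Union>J\<in>I. \<Union>z\<in>L J. (+) (s J + z) ` W J z) \<in> lmeasurable"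
    by (intro fmeasurable.finite_UN I Um)
  have NUm: "N \<union> (\<Union>J\<in>I. \<Union>z\<in>L J. (+) (s J + z) ` W J z) \<in> lmeasurable"
    by (rule fmeasurable.Un[OF negligible_imp_measurable[OF N(1)] UUm])
  ultimately have "area cell \<le> area (N \<union> (\<Union>J\<in>I. \<Union>z\<in>L J. (+) (s J + z) ` W J z))"
    using cell_measurable by (intro measure_mono_fmeasurable[OF _ _ NUm]) auto
  also have "\<dots> \<le> area N + area (\<Union>J\<in>I. \<Union>z\<in>L J. (+) (s J + z) ` W J z)"
    using Nm UUm by (intro measure_Un_le) auto
  also have "area N = 0" using N(1) by (rule negligible_imp_measure0)
  also have "area (\<Union>J\<in>I. \<Union>z\<in>L J. (+) (s J + z) ` W J z) \<le>
      (\<Sum>J\<in>I. area (\<Union>z\<in>L J. (+) (s J + z) ` W J z))"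
    using I Um by (intro measure_UNION_le) auto
  also have "\<dots> \<le> (\<Sum>J\<in>I. area Y)"
  proof (rule sum_mono)
    fix J
    have "area (\<Union>z\<in>L J. (+) (s J + z) ` W J z) \<le> (\<Sum>z\<in>L J. area ((+) (s J + z) ` W J z))"
      using fin tWm by (intro measure_UNION_le) (auto intro: fmeasurableD)
    then show "area (\<Union>z\<in>L J. (+) (s J + z) ` W J z) \<le> area Y"
      using W[of J] by (simp add: measure_translation)
  qed
  finally show ?thesis by simp
qed

end

section \<open>Odd covers from lattice shifts\<close>

lemma in_uminus_image_iff: "(x :: 'a::group_add) \<in> uminus ` S \<longleftrightarrow> - x \<in> S"
  by (metis image_iff minus_minus)

lemma odd_card_nonempty: "odd (card S) \<Longrightarrow> \<exists>x. x \<in> S"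
  by (cases "S = {}") auto

lemma odd_sum_imp_odd:
  fixes f :: "'a \<Rightarrow> nat"
  shows "odd (sum f A) \<Longrightarrow> \<exists>a\<in>A. odd (f a)"
  by (meson dvd_sum)

text \<open>One more translate replaces the odd set by its symmetric difference with that
  translate.\<close>

lemma odd_translates_measurable:
  assumes "finite K" "P \<in> sets lebesgue"
  shows "{x :: 'a::euclidean_space. odd (card {k \<in> K. x \<in> (+) k ` P})} \<in> sets lebesgue"
  using assms(1)
proof induction
  case (insert k K)
  let ?Y = "{x. odd (card {k \<in> K. x \<in> (+) k ` P})}"
  have k: "(+) k ` P \<in> sets lebesgue" by (rule lebesgue_sets_translation[OF assms(2)])
  have "{j \<in> insert k K. x \<in> (+) j ` P} =
      (if x \<in> (+) k ` P then insert k {j \<in> K. x \<in> (+) j ` P} else {j \<in> K. x \<in> (+) j ` P})" for x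
    by auto
  then have "{x. odd (card {j \<in> insert k K. x \<in> (+) j ` P})} = (?Y - (+) k ` P) \<union> ((+) k ` P - ?Y)"
    using insert.hyps by (auto split: if_splits)
  then show ?case using insert.IH k by auto
qed simp

section \<open>Covers by finitely many shifted copies of the lattice\<close>

context planar_lattice
begin

context
  fixes I :: "'i set" and P :: "(real^2) set" and s :: "'i \<Rightarrow> real^2"
  assumes I: "finite I" and P: "compact P"
    and odd: "AE x in lebesgue. odd (\<Sum>J\<in>I. card {z \<in> lattice. x - s J - z \<in> P})"
begin

lemma hit_bound: "\<exists>N. \<forall>x J. finite {z \<in> lattice. x - s J - z \<in> P} \<and> card {z \<in> lattice. x - s J - z \<in> P} \<le> N"
proof -
  have "bounded (uminus ` P)" using P compact_imp_bounded by simp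
  from lattice_points_bounded[OF this] obtain N where N: "\<And>c. finite {z \<in> lattice. c + z \<in> uminus ` P} \<and>
      card {z \<in> lattice. c + z \<in> uminus ` P} \<le> N" by blast
  have eq: "{z \<in> lattice. x - s J - z \<in> P} = {z \<in> lattice. - (x - s J) + z \<in> uminus ` P}" for x J
    unfolding in_uminus_image_iff by simp
  show ?thesis unfolding eq using N by blast
qed

lemma finite_lattice_hits: "finite {z \<in> lattice. x - s J - z \<in> P}"
  using hit_bound by blast

text \<open>Shifted lattices for different \<open>J\<close> may coincide; a translation is then
  taken once for each of them.\<close>

definition shift_count :: "real^2 \<Rightarrow> nat" where
  "shift_count z = card {J \<in> I. z - s J \<in> lattice}"

lemma shift_count_pos_iff: "0 < shift_count z \<longleftrightarrow> (\<exists>J\<in>I. z - s J \<in> lattice)"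
  using I by (auto simp: shift_count_def card_gt_0_iff)

lemma finite_support:
  assumes "bounded B"
  shows "finite {z. 0 < shift_count z \<and> z \<in> B}"
proof -
  have "finite (\<Union>J\<in>I. (+) (s J) ` {z \<in> lattice. s J + z \<in> B})"
    using I finite_lattice_points[OF assms] by blast
  moreover have "{z. 0 < shift_count z \<and> z \<in> B} \<subseteq> (\<Union>J\<in>I. (+) (s J) ` {z \<in> lattice. s J + z \<in> B})"
    by (auto simp: shift_count_pos_iff in_translation_iff)
  ultimately show ?thesis by (rule finite_subset[rotated])
qed

lemma sum_shift_count:
  assumes "finite W" "W \<subseteq> {z. 0 < shift_count z}"
  shows "sum shift_count W = (\<Sum>J\<in>I. card {z \<in> W. z - s J \<in> lattice})"
  unfolding shift_count_def by (rule sum_multicount_gen) (use assms I in auto)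

text \<open>The members at \<open>x\<close> are regrouped by the index \<open>J\<close> of their
  shifted lattice; subtracting \<open>s J\<close> then turns translations into lattice
  points.\<close>

lemma card_members_at:
  shows "finite (members_at P shift_count x)"
    and "card (members_at P shift_count x) = (\<Sum>J\<in>I. card {z \<in> lattice. x - s J - z \<in> P})"
proof -
  define W where "W = {z. 0 < shift_count z \<and> x - z \<in> P}"
  have eq: "members_at P shift_count x = Sigma W (\<lambda>z. {..<shift_count z})"
    by (auto simp: members_at_def W_def in_translation_iff)
  have "bounded ((+) x ` uminus ` P)"
    using P compact_imp_bounded by (intro bounded_translation) simp
  then have "finite {z. 0 < shift_count z \<and> z \<in> (+) x ` uminus ` P}" by (rule finite_support)
  moreover have "W \<subseteq> {z. 0 < shift_count z \<and> z \<in> (+) x ` uminus ` P}"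
    by (auto simp only: W_def in_translation_iff in_uminus_image_iff minus_diff_eq)
  ultimately have W: "finite W" by (rule finite_subset[rotated])
  show "finite (members_at P shift_count x)" unfolding eq using W by auto
  have "card (members_at P shift_count x) = sum shift_count W"
    unfolding eq using W by (subst card_SigmaI) auto
  also have "\<dots> = (\<Sum>J\<in>I. card {z \<in> W. z - s J \<in> lattice})"
    by (rule sum_shift_count[OF W]) (auto simp: W_def)
  also have "\<dots> = (\<Sum>J\<in>I. card {z \<in> lattice. x - s J - z \<in> P})"
  proof (rule sum.cong)
    fix J assume J: "J \<in> I"
    have "bij_betw (\<lambda>z. z - s J) {z \<in> W. z - s J \<in> lattice} {z \<in> lattice. x - s J - z \<in> P}"
      by (rule bij_betwI[where g = "\<lambda>z. s J + z"])
        (use J in \<open>auto simp: W_def shift_count_pos_iff diff_diff_eq intro!: bexI[of _ J]\<close>)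
    then show "card {z \<in> W. z - s J \<in> lattice} = card {z \<in> lattice. x - s J - z \<in> P}"
      by (rule bij_betw_same_card)
  qed simp
  finally show "card (members_at P shift_count x) = (\<Sum>J\<in>I. card {z \<in> lattice. x - s J - z \<in> P})" .
qed

text \<open>The translations are locally finite, so removing finitely many others from a ball around
  one of them isolates it.\<close>

lemma shift_count_discrete: "discrete_translations shift_count"
  unfolding discrete_translations_def discrete_def
proof
  fix z assume z: "z \<in> {z. 0 < shift_count z}"
  define F where "F = {w. 0 < shift_count w \<and> w \<in> ball z 1} - {z}"
  have "finite F" unfolding F_def by (intro finite_Diff finite_support bounded_ball)
  then have "open (ball z 1 - F)" by (intro open_Diff finite_imp_closed) auto
  moreover have "(ball z 1 - F) \<inter> {z. 0 < shift_count z} = {z}" using z by (auto simp: F_def)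
  ultimately show "z isolated_in {z. 0 < shift_count z}" using z unfolding isolated_in_def by blast
qed

lemma shift_count_bounded_degree: "uniformly_bounded_degree P shift_count"
proof -
  obtain N where N: "\<And>x J. card {z \<in> lattice. x - s J - z \<in> P} \<le> N" using hit_bound by blast
  have "card (members_at P shift_count x) \<le> card I * N" for x
    unfolding card_members_at(2) using sum_bounded_above[of I _ N] N by simp
  then show ?thesis using card_members_at(1) unfolding uniformly_bounded_degree_def by blast
qed

lemma shift_count_odd_cover: "odd_cover P shift_count"
  using odd by (simp add: odd_cover_def card_members_at(2))

text \<open>A translate contributes at most \<open>area P\<close>, and only if it meets the square.
  For each \<open>J\<close> at most \<open>(n + 2 * R J)\<^sup>2 / area cell\<close> of them do;
  divided by \<open>n\<^sup>2\<close> this tends to \<open>\<bar>det A\<bar>\<close>, the inverse of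
  the cell area.\<close>

lemma shift_count_density: "cover_density P shift_count \<le> ennreal (card I * area P * \<bar>det A\<bar>)"
proof -
  have Pm: "P \<in> lmeasurable" by (rule lmeasurable_compact[OF P])
  have "bounded ((+) (s J) ` P)" for J using P compact_imp_bounded bounded_translation by blast
  then have "\<forall>J. \<exists>R. \<forall>n. finite {z \<in> lattice. \<exists>b\<in>(+) (s J) ` P. z + b \<in> centered_square n} \<and>
    card {z \<in> lattice. \<exists>b\<in>(+) (s J) ` P. z + b \<in> centered_square n} * area cell \<le> (real n + 2 * R)\<^sup>2"
    using lattice_points_near_square by blast
  from choice[OF this] obtain R where R: "\<And>J n. finite {z \<in> lattice. \<exists>b\<in>(+) (s J) ` P. z + b \<in> centered_square n}"
    "\<And>J n. card {z \<in> lattice. \<exists>b\<in>(+) (s J) ` P. z + b \<in> centered_square n} * area cell \<le> (real n + 2 * R J)\<^sup>2"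
    by blast
  define S where "S J n = {z \<in> lattice. \<exists>b\<in>(+) (s J) ` P. z + b \<in> centered_square n}" for J n
  define g where "g n = (\<Sum>J\<in>I. (1 + 2 * R J / real n)\<^sup>2 / area cell * area P)" for n
  have bound: "(\<Sum>\<^sub>\<infinity>z\<in>{z. 0 < shift_count z}. of_nat (shift_count z) * emeasure lebesgue (centered_square n \<inter> (+) z ` P))
      / ennreal ((real n)\<^sup>2) \<le> ennreal (g n)" if n: "0 < n" for n
  proof -
    \<comment> \<open>Terms outside this finite set vanish, which reduces the infinite sum to a
      finite one.\<close>
    define W where "W = {z. 0 < shift_count z \<and> centered_square n \<inter> (+) z ` P \<noteq> {}}"
    have Ssub: "(\<lambda>z. z - s J) ` {z \<in> W. z - s J \<in> lattice} \<subseteq> S J n" for J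
    proof
      fix w assume "w \<in> (\<lambda>z. z - s J) ` {z \<in> W. z - s J \<in> lattice}"
      then obtain z where z: "w = z - s J" "z \<in> W" "w \<in> lattice" by auto
      then obtain b where b: "b \<in> P" "z + b \<in> centered_square n" by (auto simp: W_def)
      then have "w + (s J + b) \<in> centered_square n" by (simp add: z(1))
      then show "w \<in> S J n" using b z(3) by (auto simp: S_def)
    qed
    have finS: "finite (S J n)" for J using R(1) by (simp add: S_def)
    have "W \<subseteq> (\<Union>J\<in>I. (+) (s J) ` S J n)"
    proof
      fix z assume z: "z \<in> W"
      then obtain J where J: "J \<in> I" "z - s J \<in> lattice" by (auto simp: W_def shift_count_pos_iff)
      then have "z - s J \<in> S J n" using Ssub[of J] z by blast
      then show "z \<in> (\<Union>J\<in>I. (+) (s J) ` S J n)" using J by (auto simp: in_translation_iff)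
    qed
    then have W: "finite W" using I finS by (meson finite_UN_I finite_imageI finite_subset)
    have "(\<Sum>\<^sub>\<infinity>z\<in>{z. 0 < shift_count z}. of_nat (shift_count z) * emeasure lebesgue (centered_square n \<inter> (+) z ` P)) =
        (\<Sum>\<^sub>\<infinity>z\<in>W. of_nat (shift_count z) * emeasure lebesgue (centered_square n \<inter> (+) z ` P))"
      by (rule infsum_cong_neutral) (auto simp: W_def)
    also have "\<dots> = (\<Sum>z\<in>W. of_nat (shift_count z) * emeasure lebesgue (centered_square n \<inter> (+) z ` P))"
      using W by simp
    also have "\<dots> \<le> (\<Sum>z\<in>W. of_nat (shift_count z) * ennreal (area P))"
    proof (intro sum_mono mult_left_mono)
      fix z
      have "emeasure lebesgue (centered_square n \<inter> (+) z ` P) \<le> emeasure lebesgue ((+) z ` P)"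
        using Pm by (intro emeasure_mono fmeasurableD measurable_translation) auto
      also have "\<dots> = ennreal (area P)"
        using emeasure_eq_measure2[OF measurable_translation[OF Pm]] by (simp add: measure_translation)
      finally show "emeasure lebesgue (centered_square n \<inter> (+) z ` P) \<le> ennreal (area P)" .
    qed simp
    also have "\<dots> = of_nat (sum shift_count W) * ennreal (area P)"
      by (simp add: sum_distrib_right)
    also have "\<dots> = ennreal (real (sum shift_count W) * area P)"
      by (simp add: ennreal_mult ennreal_of_nat_eq_real_of_nat del: of_nat_sum)
    also have "\<dots> \<le> ennreal ((\<Sum>J\<in>I. (real n + 2 * R J)\<^sup>2 / area cell) * area P)"
    proof (intro ennreal_leI mult_right_mono)
      have "real (sum shift_count W) = (\<Sum>J\<in>I. real (card {z \<in> W. z - s J \<in> lattice}))"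
        by (subst sum_shift_count[OF W]) (auto simp: W_def)
      also have "\<dots> \<le> (\<Sum>J\<in>I. (real n + 2 * R J)\<^sup>2 / area cell)"
      proof (rule sum_mono)
        fix J
        have "card {z \<in> W. z - s J \<in> lattice} \<le> card (S J n)"
          by (rule card_inj_on_le[OF _ Ssub finS]) (auto intro!: inj_onI)
        then have "real (card {z \<in> W. z - s J \<in> lattice}) * area cell \<le> real (card (S J n)) * area cell"
          using area_cell_pos by simp
        also have "\<dots> \<le> (real n + 2 * R J)\<^sup>2" using R(2) by (simp add: S_def)
        finally show "real (card {z \<in> W. z - s J \<in> lattice}) \<le> (real n + 2 * R J)\<^sup>2 / area cell"
          using area_cell_pos by (simp add: pos_le_divide_eq)
      qed
      finally show "real (sum shift_count W) \<le> (\<Sum>J\<in>I. (real n + 2 * R J)\<^sup>2 / area cell)" .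
    qed simp
    finally have "(\<Sum>\<^sub>\<infinity>z\<in>{z. 0 < shift_count z}. of_nat (shift_count z) * emeasure lebesgue (centered_square n \<inter> (+) z ` P))
      / ennreal ((real n)\<^sup>2) \<le> ennreal ((\<Sum>J\<in>I. (real n + 2 * R J)\<^sup>2 / area cell) * area P) / ennreal ((real n)\<^sup>2)"
      by (rule divide_right_mono_ennreal)
    also have "\<dots> = ennreal ((\<Sum>J\<in>I. (real n + 2 * R J)\<^sup>2 / area cell) * area P / (real n)\<^sup>2)"
      using n area_cell_pos by (intro divide_ennreal) (auto intro!: mult_nonneg_nonneg sum_nonneg)
    also have "(\<Sum>J\<in>I. (real n + 2 * R J)\<^sup>2 / area cell) * area P / (real n)\<^sup>2 = g n"
    proof -
      have "(real n + 2 * R J)\<^sup>2 / (real n)\<^sup>2 = (1 + 2 * R J / real n)\<^sup>2" for J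
        using n by (simp add: field_simps flip: power_divide)
      then have "(real n + 2 * R J)\<^sup>2 / area cell * area P / (real n)\<^sup>2 =
          (1 + 2 * R J / real n)\<^sup>2 / area cell * area P" for J
        by (metis (no_types, opaque_lifting) divide_divide_eq_left' mult.commute times_divide_eq_left)
      then show ?thesis by (simp add: g_def sum_distrib_right sum_divide_distrib)
    qed
    finally show ?thesis .
  qed
  have "(\<lambda>n. (1 + 2 * R J / real n)\<^sup>2 / area cell * area P) \<longlonglongrightarrow> (1 + 0)\<^sup>2 / area cell * area P" for J
    by (intro tendsto_intros lim_const_over_n) (use area_cell_pos in auto)
  then have "g \<longlonglongrightarrow> (\<Sum>J\<in>I. (1 + 0)\<^sup>2 / area cell * area P)"
    unfolding g_def by (intro tendsto_sum)
  then have "(\<lambda>n. ennreal (g n)) \<longlonglongrightarrow> ennreal (card I * area P * \<bar>det A\<bar>)"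
    by (intro tendsto_ennrealI) (simp add: area_cell algebra_simps)
  then have "liminf (\<lambda>n. ennreal (g n)) = ennreal (card I * area P * \<bar>det A\<bar>)"
    by (rule lim_imp_Liminf[rotated]) simp
  moreover have "cover_density P shift_count \<le> liminf (\<lambda>n. ennreal (g n))"
    unfolding cover_density_def
    by (intro Liminf_mono eventually_sequentiallyI[of 1] bound) simp
  ultimately show ?thesis by simp
qed

lemma ex_odd_cover:
  "\<exists>m. discrete_translations m \<and> uniformly_bounded_degree P m \<and> odd_cover P m \<and>
    cover_density P m \<le> ennreal (card I * area P * \<bar>det A\<bar>)"
  using shift_count_discrete shift_count_bounded_degree shift_count_odd_cover shift_count_density by blast

text \<open>Adding up the cover counts at the points \<open>x - k\<close> gives a sum of an odd
  number of odd numbers. After exchanging summations there are \<open>J\<close> and \<open>z\<close>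
  such that an odd number of \<open>k\<close> satisfy \<open>x - s J - z - k \<in> P\<close>. Hence
  translates of the odd set cover the plane, and \<open>covering_area\<close> applies.\<close>

lemma odd_translates_area:
  assumes K: "finite K" "odd (card K)"
  shows "1 \<le> card I * \<bar>det A\<bar> * area {x. odd (card {k \<in> K. x \<in> (+) k ` P})}"
proof -
  define Y where "Y = {x. odd (card {k \<in> K. x \<in> (+) k ` P})}"
  have bdP: "bounded P" and mP: "P \<in> sets lebesgue"
    using P compact_imp_bounded lmeasurable_compact fmeasurableD by blast+
  have "bounded (\<Union>k\<in>K. (+) k ` P)" using K(1) bdP bounded_translation by blast
  moreover have "Y \<subseteq> (\<Union>k\<in>K. (+) k ` P)"
  proof
    fix x assume "x \<in> Y"
    then have "odd (card {k \<in> K. x \<in> (+) k ` P})" unfolding Y_def by blast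
    from odd_card_nonempty[OF this] show "x \<in> (\<Union>k\<in>K. (+) k ` P)" by blast
  qed
  ultimately have Yb: "bounded Y" using bounded_subset by blast
  have Ym: "Y \<in> lmeasurable"
    using bounded_set_imp_lmeasurable[OF Yb] odd_translates_measurable[OF K(1) mP] by (simp add: Y_def)
  have "AE x in lebesgue. \<forall>k\<in>K. odd (\<Sum>J\<in>I. card {z \<in> lattice. x - k - s J - z \<in> P})"
    using K(1) AE_shift[OF odd] by (subst AE_ball_countable) (auto simp: countable_finite)
  then have "AE x in lebesgue. \<exists>J\<in>I. \<exists>z\<in>lattice. x - s J - z \<in> Y"
  proof eventually_elim
    case (elim x)
    define N where "N k J = {z \<in> lattice. x - k - s J - z \<in> P}" for k J
    have fin: "finite (N k J)" for k J unfolding N_def by (rule finite_lattice_hits)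
    have "{k \<in> K. odd (\<Sum>J\<in>I. card (N k J))} = K" using elim by (auto simp: N_def)
    then have "odd (\<Sum>k\<in>K. \<Sum>J\<in>I. card (N k J))" using K by (simp add: even_sum_iff)
    then have "odd (\<Sum>J\<in>I. \<Sum>k\<in>K. card (N k J))" by (subst sum.swap)
    from odd_sum_imp_odd[OF this] obtain J where J: "J \<in> I" "odd (\<Sum>k\<in>K. card (N k J))" by blast
    define L where "L = (\<Union>k\<in>K. N k J)"
    have L: "finite L" using fin K by (simp add: L_def)
    have "(\<Sum>z\<in>L. card {k \<in> K. z \<in> N k J}) = (\<Sum>k\<in>K. card (N k J))"
    proof (rule sum_multicount_gen[OF L K(1)])
      show "\<forall>k\<in>K. card {z \<in> L. z \<in> N k J} = card (N k J)"
        by (auto simp: L_def intro!: arg_cong[where f = card])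
    qed
    then have "odd (\<Sum>z\<in>L. card {k \<in> K. z \<in> N k J})" using J(2) by simp
    from odd_sum_imp_odd[OF this] obtain z where z: "z \<in> L" "odd (card {k \<in> K. z \<in> N k J})" by blast
    have "{k \<in> K. z \<in> N k J} = {k \<in> K. x - s J - z \<in> (+) k ` P}"
      using z(1) by (auto simp: N_def L_def in_translation_iff algebra_simps)
    then have "x - s J - z \<in> Y" using z(2) by (simp add: Y_def)
    moreover have "z \<in> lattice" using z(1) by (auto simp: L_def N_def)
    ultimately show ?case using J(1) by blast
  qed
  then have "area cell \<le> card I * area Y" by (rule covering_area[OF I Ym Yb])
  then show ?thesis
    using det_A by (simp add: area_cell Y_def field_simps)
qed

end

end

section \<open>The minimal integer polygon\<close>

lemma area_affine_image:
  fixes A :: "real^2^2"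
  assumes "P \<in> lmeasurable"
  shows "area ((\<lambda>x. A *v x + b) ` P) = \<bar>det A\<bar> * area P"
proof -
  have "(\<lambda>x. A *v x + b) ` P = (+) b ` (*v) A ` P" by (auto simp: image_image add.commute)
  then show ?thesis
    using assms by (simp only: measure_translation) (simp add: measure_linear_image)
qed

lemma polygon_measurable:
  assumes "polygon_with_vertices P vs"
  shows "P \<in> lmeasurable"
  using polygon_Jordan(9)[OF assms] by (rule lmeasurable_compact)

lemma polygon_area_pos:
  assumes "polygon_with_vertices P vs"
  shows "0 < area P"
proof -
  note J = polygon_Jordan[OF assms]
  have "\<not> negligible (inside (\<Union>i<length vs. edge vs i))"
    using J(4,5) open_not_negligible by blast
  then have "\<not> negligible P" using J(2) negligible_subset by blast
  then have "area P \<noteq> 0" using polygon_measurable[OF assms] negligible_iff_measure by blast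
  then show ?thesis by (simp add: less_le)
qed

lemma no_parallel_edges_affine:
  fixes A :: "real^2^2"
  assumes "invertible A" "no_parallel_edges vs" "vs \<noteq> []"
  shows "no_parallel_edges (map (\<lambda>x. A *v x + b) vs)"
  unfolding no_parallel_edges_def
proof (intro allI impI notI)
  let ?T = "\<lambda>x. A *v x + b"
  fix i j assume ij: "i < length (map ?T vs)" "j < length (map ?T vs)" "i \<noteq> j"
    and par: "parallel (next_vertex (map ?T vs) i - map ?T vs ! i) (next_vertex (map ?T vs) j - map ?T vs ! j)"
  have diff: "next_vertex (map ?T vs) i - map ?T vs ! i = A *v (next_vertex vs i - vs ! i)" if "i < length vs" for i
  proof -
    have "Suc i mod length vs < length vs" using assms(3) by simp
    then show ?thesis using that by (simp add: matrix_vector_mult_diff_distrib)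
  qed
  have zero: "det2 u v = 0" if "parallel u v" for u v
    using that unfolding parallel_def collinear_lemma by auto
  have "det A * det2 (next_vertex vs i - vs ! i) (next_vertex vs j - vs ! j) = 0"
  proof -
    have "i < length vs" "j < length vs" using ij by simp_all
    then show ?thesis using zero[OF par] unfolding det2_matrix[symmetric] by (simp only: diff)
  qed
  moreover have "det A \<noteq> 0" using assms(1) by (simp add: invertible_det_nz)
  ultimately show False using edges_not_parallel[OF assms(2)] ij by simp
qed

section \<open>Existence of a minimal integer polygon\<close>

lemma ex_common_denominator:
  assumes "\<forall>v\<in>set vs. rational_point v"
  shows "\<exists>N::int. 0 < N \<and> (\<forall>v\<in>set vs. integer_point (of_int N *\<^sub>R v))"
  using assms
proof (induction vs)
  case (Cons v vs)
  have "\<exists>N::int. 0 < N \<and> of_int N * x \<in> \<int>" if x: "x \<in> \<rat>" for x :: real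
  proof -
    obtain a b where ab: "b > 0" "x = of_int a / of_int b" using x by (auto elim: Rats_cases')
    then have "of_int b * x = of_int a" by simp
    then show ?thesis using ab(1) by (metis Ints_of_int)
  qed
  then have "\<exists>N::int. 0 < N \<and> of_int N * v $ j \<in> \<int>" for j
    using Cons.prems by (simp add: rational_point_def)
  then obtain M where M: "\<And>j. 0 < M j" "\<And>j. of_int (M j) * v $ j \<in> \<int>" by metis
  obtain N where N: "0 < N" "\<And>v. v \<in> set vs \<Longrightarrow> integer_point (of_int N *\<^sub>R v)"
    using Cons by auto
  define L where "L = M 1 * M 2 * N"
  have "0 < L" using M N by (simp add: L_def)
  moreover have "integer_point (of_int L *\<^sub>R v)"
  proof -
    have "of_int L * v $ 1 = of_int (M 2 * N) * (of_int (M 1) * v $ 1)"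
      "of_int L * v $ 2 = of_int (M 1 * N) * (of_int (M 2) * v $ 2)"
      by (simp_all add: L_def)
    then have "of_int L * v $ 1 \<in> \<int>" "of_int L * v $ 2 \<in> \<int>"
      using M(2) by (simp_all only: Ints_mult Ints_of_int)
    then show ?thesis by (simp add: integer_point_def forall_2)
  qed
  moreover have "integer_point (of_int L *\<^sub>R w)" if "w \<in> set vs" for w
    using integer_point_simps(5)[OF N(2)[OF that], of "M 1 * M 2"] by (simp add: L_def)
  ultimately show ?case by auto
qed (auto intro: exI[of _ 1])

lemma scalar_matrix_vector: "(c *\<^sub>R mat 1 :: real^'n^'n) *v x = c *\<^sub>R x"
  by (simp add: scaleR_matrix_vector_assoc[symmetric])

lemma invertible_scalar:
  assumes "c \<noteq> 0"
  shows "invertible (c *\<^sub>R mat 1 :: real^'n^'n)"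
  using assms by (rule scalar_invertible) (auto simp: invertible_def intro!: exI[of _ "mat 1"])

lemma affinely_equivalent_trans:
  assumes "affinely_equivalent P Q" "affinely_equivalent Q R"
  shows "affinely_equivalent P R"
proof -
  obtain A b where A: "invertible (A :: real^2^2)" "Q = (\<lambda>x. A *v x + b) ` P"
    using assms(1) by (auto simp: affinely_equivalent_def)
  obtain B c where B: "invertible (B :: real^2^2)" "R = (\<lambda>x. B *v x + c) ` Q"
    using assms(2) by (auto simp: affinely_equivalent_def)
  have "R = (\<lambda>x. (B ** A) *v x + (B *v b + c)) ` P"
    by (simp add: A B image_image matrix_vector_right_distrib matrix_vector_mul_assoc add.assoc)
  moreover have "invertible (B ** A)" using A B by (simp add: invertible_mult)
  ultimately show ?thesis unfolding affinely_equivalent_def by blast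
qed

text \<open>\<open>integer_polygon\<close> only promises some integral vertex list;
  \<open>polygon_vertices_unique\<close> transfers integrality to the images of the given
  vertices.\<close>

lemma integer_polygon_image:
  assumes P: "polygon_with_vertices P vs" and "invertible A"
    and int: "integer_polygon ((\<lambda>x. A *v x + b) ` P)" and "v \<in> set vs"
  shows "integer_point (A *v v + b)"
proof -
  let ?T = "\<lambda>x. A *v x + b"
  obtain ws where ws: "polygon_with_vertices (?T ` P) ws" "\<forall>w\<in>set ws. integer_point w"
    using int by (auto simp: integer_polygon_def)
  have "set (map ?T vs) \<subseteq> set ws"
    by (rule polygon_vertices_unique[OF polygon_affine_image[OF assms(2) P] ws(1)])
  then show ?thesis using ws(2) assms(4) by auto
qed

text \<open>The minimum exists because areas are discrete: \<open>A\<close> maps the edge vectors \<open>e\<close>, \<open>f\<close> to integer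
  vectors, so \<open>\<bar>det A\<bar> * \<bar>det2 e f\<bar>\<close> is a natural number.\<close>

lemma P_INT_minimal:
  assumes P: "polygon_with_vertices P vs" and rat: "\<forall>v\<in>set vs. rational_point v"
    and npar: "no_parallel_edges vs"
  shows "integer_polygon (P_INT P)" "affinely_equivalent P (P_INT P)"
    and "\<And>Q. integer_polygon Q \<Longrightarrow> affinely_equivalent P Q \<Longrightarrow> area (P_INT P) \<le> area Q"
proof -
  define good where "good Q \<longleftrightarrow> integer_polygon Q \<and> affinely_equivalent P Q" for Q
  have len: "3 \<le> length vs" by (rule polygon_edges(1)[OF P])
  define e f where "e = vs ! 1 - vs ! 0" and "f = vs ! 2 - vs ! 1"
  have ef: "det2 e f \<noteq> 0"
    using edges_not_parallel[OF npar, of 0 1] len polygon_edges(2)[OF P] by (simp add: e_def f_def numeral_2_eq_2 del: det2_simps)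
  \<comment> \<open>Normalised so that \<open>area Q * \<kappa>\<close> equals
    \<open>\<bar>det A\<bar> * \<bar>det2 e f\<bar>\<close> for every affine image \<open>Q\<close>
    of \<open>P\<close> with matrix \<open>A\<close>.\<close>
  define \<kappa> where "\<kappa> = \<bar>det2 e f\<bar> / area P"
  have aP: "0 < area P" by (rule polygon_area_pos[OF P])
  have \<kappa>: "0 < \<kappa>" using ef aP by (simp add: \<kappa>_def)
  define \<mu> where "\<mu> Q = nat \<lfloor>area Q * \<kappa>\<rfloor>" for Q
  have \<mu>: "area Q * \<kappa> = real (\<mu> Q)" if Q: "good Q" for Q
  proof -
    obtain A b where A: "invertible (A :: real^2^2)" "Q = (\<lambda>x. A *v x + b) ` P"
      using Q by (auto simp: good_def affinely_equivalent_def)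
    have int: "integer_point (A *v v + b)" if "v \<in> set vs" for v
      using integer_polygon_image[OF P A(1) _ that] Q A(2) by (simp add: good_def)
    have "vs ! 0 \<in> set vs" "vs ! 1 \<in> set vs" "vs ! 2 \<in> set vs"
      using len by (auto intro!: nth_mem)
    then have "integer_point (A *v vs ! 1 + b - (A *v vs ! 0 + b))"
      "integer_point (A *v vs ! 2 + b - (A *v vs ! 1 + b))"
      using int integer_point_simps(4) by blast+
    then have "integer_point (A *v e)" "integer_point (A *v f)"
      by (simp_all add: e_def f_def matrix_vector_mult_diff_distrib)
    then have "det2 (A *v e) (A *v f) \<in> \<int>" by (rule det2_integer)
    then obtain n where "det A * det2 e f = of_int n" by (auto simp: det2_matrix elim: Ints_cases)
    then have "\<bar>det A\<bar> * \<bar>det2 e f\<bar> = of_int \<bar>n\<bar>" by (simp flip: abs_mult)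
    moreover have "area Q = \<bar>det A\<bar> * area P"
      unfolding A(2) by (rule area_affine_image[OF polygon_measurable[OF P]])
    ultimately have "area Q * \<kappa> = of_int \<bar>n\<bar>" using aP by (simp add: \<kappa>_def)
    then show ?thesis by (simp add: \<mu>_def)
  qed
  \<comment> \<open>Scaling by a common denominator provides one candidate, so that a least value of
    \<open>\<mu>\<close> exists.\<close>
  obtain N :: int where N: "0 < N" "\<forall>v\<in>set vs. integer_point (of_int N *\<^sub>R v)"
    using ex_common_denominator[OF rat] by blast
  define M :: "real^2^2" where "M = of_int N *\<^sub>R mat 1"
  have M: "invertible M" unfolding M_def by (rule invertible_scalar) (use N in auto)
  have "polygon_with_vertices ((\<lambda>x. M *v x + 0) ` P) (map (\<lambda>x. M *v x + 0) vs)"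
    by (rule polygon_affine_image[OF M P])
  moreover have "\<forall>v\<in>set (map (\<lambda>x. M *v x + 0) vs). integer_point v"
    using N by (auto simp: M_def scalar_matrix_vector)
  ultimately have "good ((\<lambda>x. M *v x + 0) ` P)"
    using M unfolding good_def integer_polygon_def affinely_equivalent_def by blast
  from ex_has_least_nat[of good, OF this, of \<mu>]
  obtain Q0 where Q0: "good Q0" "\<And>Q. good Q \<Longrightarrow> \<mu> Q0 \<le> \<mu> Q" by blast
  have min: "area Q0 \<le> area Q" if "good Q" for Q
    using Q0(2)[OF that] \<mu>[OF Q0(1)] \<mu>[OF that] \<kappa> by (metis mult_le_cancel_right_pos of_nat_le_iff)
  have "good (P_INT P) \<and> (\<forall>Q. good Q \<longrightarrow> area (P_INT P) \<le> area Q)"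
    unfolding P_INT_def good_def[symmetric]
    by (rule arg_minI[of good Q0]) (use Q0(1) min in \<open>auto simp: not_less\<close>)
  then show "integer_polygon (P_INT P)" "affinely_equivalent P (P_INT P)"
    "\<And>Q. integer_polygon Q \<Longrightarrow> affinely_equivalent P Q \<Longrightarrow> area (P_INT P) \<le> area Q"
    by (auto simp: good_def)
qed

text \<open>With vertex 0 moved to the origin, every vertex is a sum of even edge vectors; halving
  then keeps the polygon integral and divides its area by 4. For a minimal polygon this rules out
  that all \<open>d i\<close> are even.\<close>

lemma integer_polygon_halving:
  assumes Q: "polygon_with_vertices Q ws" and int: "\<forall>w\<in>set ws. integer_point w"
    and even: "\<And>i. i < length ws \<Longrightarrow> \<exists>f. integer_point f \<and> next_vertex ws i - ws ! i = 2 *\<^sub>R f"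
  shows "\<exists>R. integer_polygon R \<and> affinely_equivalent Q R \<and> area R < area Q"
proof -
  define H :: "real^2^2" where "H = (1 / 2) *\<^sub>R mat 1"
  define c where "c = - ((1 / 2) *\<^sub>R ws ! 0)"
  have H: "invertible H" unfolding H_def by (rule invertible_scalar) auto
  have half: "integer_point ((1 / 2) *\<^sub>R (ws ! i - ws ! 0))" if "i < length ws" for i
    using that
  proof (induction i)
    case (Suc i)
    then obtain f where f: "integer_point f" "ws ! Suc i - ws ! i = 2 *\<^sub>R f"
      using even[of i] by auto
    have "(1 / 2) *\<^sub>R (ws ! Suc i - ws ! 0) = (1 / 2) *\<^sub>R (ws ! Suc i - ws ! i) + (1 / 2) *\<^sub>R (ws ! i - ws ! 0)"
      by (simp add: algebra_simps)
    then show ?case using f Suc by simp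
  qed simp
  have "polygon_with_vertices ((\<lambda>x. H *v x + c) ` Q) (map (\<lambda>x. H *v x + c) ws)"
    by (rule polygon_affine_image[OF H Q])
  moreover have "\<forall>v\<in>set (map (\<lambda>x. H *v x + c) ws). integer_point v"
    using half by (auto simp: H_def c_def scalar_matrix_vector in_set_conv_nth algebra_simps)
  ultimately have "integer_polygon ((\<lambda>x. H *v x + c) ` Q)" unfolding integer_polygon_def by blast
  moreover have "affinely_equivalent Q ((\<lambda>x. H *v x + c) ` Q)"
    using H unfolding affinely_equivalent_def by blast
  moreover have "det H = 1 / 4" by (simp add: H_def det_2 mat_def)
  then have "area ((\<lambda>x. H *v x + c) ` Q) < area Q"
    using area_affine_image[OF polygon_measurable[OF Q], of H c] polygon_area_pos[OF Q] by simp
  ultimately show ?thesis by blast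
qed

text \<open>The affine map onto the minimal polygon \<open>Q\<close> carries the translates of
  \<open>P\<close> by points \<open>z\<close> with \<open>A *v z\<close> integral to the integer
  translates of \<open>Q\<close>. So \<open>odd_shifts\<close> for \<open>Q\<close> can be pulled
  back, its shifts being transformed by \<open>matrix_inv A\<close>.\<close>

lemma ex_odd_lattice_shifts:
  assumes P: "polygon_with_vertices P vs" and rat: "\<forall>v\<in>set vs. rational_point v"
    and npar: "no_parallel_edges vs"
  shows "\<exists>A s. invertible (A :: real^2^2) \<and> A_INT P = \<bar>det A\<bar> * area P \<and>
    (AE x in lebesgue. odd (\<Sum>J\<in>Pow {..<length vs - 1}. card {z. integer_point (A *v z) \<and> x - s J - z \<in> P}))"
proof -
  note min = P_INT_minimal[OF P rat npar]
  define Q where "Q = P_INT P"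
  obtain A b where A: "invertible (A :: real^2^2)" and Q: "Q = (\<lambda>x. A *v x + b) ` P"
    using min(2) by (auto simp: affinely_equivalent_def Q_def)
  define T where "T = (\<lambda>x. A *v x + b)"
  define ws where "ws = map T vs"
  have poly: "polygon_with_vertices Q ws"
    unfolding Q ws_def T_def by (rule polygon_affine_image[OF A P])
  have int: "\<forall>w\<in>set ws. integer_point w"
    using integer_polygon_image[OF P A, of b] min(1) Q by (auto simp: ws_def T_def Q_def)
  have npar': "no_parallel_edges ws"
    unfolding ws_def T_def by (rule no_parallel_edges_affine[OF A npar polygon_edges(2)[OF P]])
  have len: "length ws = length vs" by (simp add: ws_def)
  have "\<exists>(d::int) p q. 0 < d \<and> integer_point p \<and> integer_point q \<and> det2 p q = 1 \<and>
      next_vertex ws i - ws ! i = of_int d *\<^sub>R p \<and>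
      (even d \<longrightarrow> (\<exists>f. integer_point f \<and> next_vertex ws i - ws ! i = 2 *\<^sub>R f))" if i: "i < length ws" for i
  proof (rule primitive_decomposition)
    have "Suc i mod length ws < length ws" using polygon_edges(2)[OF poly] by simp
    then show "integer_point (next_vertex ws i - ws ! i)"
      using i int by (intro integer_point_simps) auto
    show "next_vertex ws i - ws ! i \<noteq> 0" using polygon_edges(3)[OF poly i] by simp
  qed
  then obtain d :: "nat \<Rightarrow> int" and p q where dpq: "\<And>i. i < length ws \<Longrightarrow>
      0 < d i \<and> integer_point (p i) \<and> integer_point (q i) \<and> det2 (p i) (q i) = 1 \<and>
      next_vertex ws i - ws ! i = of_int (d i) *\<^sub>R p i \<and>
      (even (d i) \<longrightarrow> (\<exists>f. integer_point f \<and> next_vertex ws i - ws ! i = 2 *\<^sub>R f))"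
    by metis
  interpret lattice_polygon Q ws d p q
    using poly int npar' dpq by unfold_locales auto
  \<comment> \<open>Otherwise halving would give a smaller integer polygon affinely equivalent to
    \<open>P\<close>.\<close>
  have "\<exists>l<length ws. odd (d l)"
  proof (rule ccontr)
    assume "\<not> ?thesis"
    then obtain R where "integer_polygon R" "affinely_equivalent Q R" "area R < area Q"
      using integer_polygon_halving[OF poly int] dpq by blast
    then show False
      using min(3)[of R] affinely_equivalent_trans[OF min(2), of R] by (simp add: Q_def)
  qed
  then obtain h where h: "\<And>x. (\<forall>J\<in>Pow {..<length ws - 1}. generic (x - sum h J)) \<Longrightarrow>
      odd (\<Sum>J\<in>Pow {..<length ws - 1}. card (hits (x - sum h J)))"
    using odd_shifts by blast
  define s where "s J = matrix_inv A *v sum h J" for J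
  have inv: "A *v (matrix_inv A *v x) = x" "matrix_inv A *v (A *v x) = x" for x
    using matrix_inv_mult[OF A] by (simp_all add: matrix_vector_mul_assoc)
  have T: "T (x - s J - z) = T x - sum h J - A *v z" for x J z
    by (simp add: T_def matrix_vector_mult_diff_distrib s_def inv)
  have memQ: "T x \<in> Q \<longleftrightarrow> x \<in> P" for x
    by (simp only: Q T_def inj_image_mem_iff[OF inj_affine[OF A]])
  have card_eq: "card {z. integer_point (A *v z) \<and> x - s J - z \<in> P} = card (hits (T x - sum h J))" for x J
  proof (rule bij_betw_same_card)
    show "bij_betw ((*v) A) {z. integer_point (A *v z) \<and> x - s J - z \<in> P} (hits (T x - sum h J))"
      by (rule bij_betwI[where g = "(*v) (matrix_inv A)"])
        (auto simp: hits_def inv T simp flip: memQ)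
  qed
  have "AE x in lebesgue. generic (A *v x + (b - sum h J))" for J
    using A by (intro AE_generic) (simp add: invertible_det_nz)
  then have "AE x in lebesgue. \<forall>J\<in>Pow {..<length ws - 1}. generic (A *v x + (b - sum h J))"
    by (subst AE_ball_countable) (auto intro: countable_finite)
  then have "AE x in lebesgue. odd (\<Sum>J\<in>Pow {..<length vs - 1}. card {z. integer_point (A *v z) \<and> x - s J - z \<in> P})"
  proof eventually_elim
    case (elim x)
    then show ?case
      using h[of "T x"] unfolding card_eq len by (simp add: T_def add_diff_eq)
  qed
  moreover have "A_INT P = \<bar>det A\<bar> * area P"
    using area_affine_image[OF polygon_measurable[OF P], of A b] by (simp add: A_INT_def flip: Q Q_def)
  ultimately show ?thesis using A by blast
qed

theorem theorem1:
  fixes P :: "(real^2) set" and vs :: "(real^2) list" and k :: nat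
  assumes "polygon_with_vertices P vs"
    and "length vs = k"
    and "\<forall>v\<in>set vs. rational_point v"
    and "no_parallel_edges vs"
  shows "(\<exists>m. discrete_translations m \<and> uniformly_bounded_degree P m \<and> odd_cover P m \<and>
              cover_density P m \<le> ennreal (A_INT P * 2 ^ (k - 1))) \<and>
         odd_compression_ratio P \<ge> inverse (A_INT P) * inverse (2 ^ (k - 1))"
proof -
  obtain A s where A: "invertible (A :: real^2^2)" and area: "A_INT P = \<bar>det A\<bar> * area P"
    and odd: "AE x in lebesgue. odd (\<Sum>J\<in>Pow {..<k - 1}. card {z. integer_point (A *v z) \<and> x - s J - z \<in> P})"
    using ex_odd_lattice_shifts[OF assms(1,3,4)] assms(2) by blast
  interpret planar_lattice A by unfold_locales (rule A)
  have P: "compact P" by (rule polygon_Jordan(9)[OF assms(1)])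
  have pos: "0 < area P" by (rule polygon_area_pos[OF assms(1)])
  have fin: "finite (Pow {..<k - 1})" and card: "card (Pow {..<k - 1}) = 2 ^ (k - 1)"
    by (simp_all add: card_Pow)
  have odd': "AE x in lebesgue. odd (\<Sum>J\<in>Pow {..<k - 1}. card {z \<in> lattice. x - s J - z \<in> P})"
    using odd by (simp add: lattice_def)
  note cover = fin P odd'
  have "real (card (Pow {..<k - 1})) * area P * \<bar>det A\<bar> = A_INT P * 2 ^ (k - 1)"
    unfolding card area by simp
  from ex_odd_cover[OF cover, unfolded this]
  have "\<exists>m. discrete_translations m \<and> uniformly_bounded_degree P m \<and> odd_cover P m \<and>
      cover_density P m \<le> ennreal (A_INT P * 2 ^ (k - 1))" .
  moreover
  \<comment> \<open>Dividing by \<open>area P\<close> turns this into the stated bound, since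
    \<open>A_INT P = \<bar>det A\<bar> * area P\<close>.\<close>
  have "1 / (\<bar>det A\<bar> * 2 ^ (k - 1)) \<le> odd_area P"
    unfolding odd_area_def
  proof (rule cINF_greatest)
    show "{K. finite K \<and> odd (card K)} \<noteq> ({} :: (real^2) set set)"
      by (auto intro!: exI[of _ "{0}"])
    fix K :: "(real^2) set" assume "K \<in> {K. finite K \<and> odd (card K)}"
    then show "1 / (\<bar>det A\<bar> * 2 ^ (k - 1)) \<le> area {x. odd (card {k \<in> K. x \<in> (+) k ` P})}"
      using odd_translates_area[OF cover, of K] det_A unfolding card by (simp add: field_simps)
  qed
  then have "1 / (\<bar>det A\<bar> * 2 ^ (k - 1)) / area P \<le> odd_compression_ratio P"
    using pos unfolding odd_compression_ratio_def by (intro divide_right_mono) auto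
  then have "inverse (A_INT P) * inverse (2 ^ (k - 1)) \<le> odd_compression_ratio P"
    by (simp add: area field_simps)
  ultimately show ?thesis by blast
qed

end
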